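(* Let $G$ be a skew-symmetric graph having the degree property and the loop property. Then $G$ is weakly acyclic if and only if the algorithm Acyclicity-Test, applied to $G$, reports no regular cycle.
   Context: All graphs are finite. A skew-symmetric graph is a digraph $G$ (node set $V_G$, arc set $A_G$) endowed with an involution $\sigma$ on $V_G\cup A_G$, mapping nodes to nodes and arcs to arcs, with no fixed nodes and no fixed arcs, such that for each arc $a$ from $u$ to $v$, $\sigma(a)$ is an arc from $\sigma(v)$ to $\sigma(u)$. We write $x'=\sigma(x)$ (the mate of $x$), $X'=\sigma(X)$; a node set $X$ is self-symmetric if $X'=X$. $G[X]$ is the induced subgraph. A path (circuit) is a node-simple directed walk (cycle); it is regular if it contains no pair of mutually symmetric arcs $a,a'$. $G$ is weakly acyclic if it has no regular circuits. Degree property: for each node $v$, at most one arc enters $v$ or at most one arc leaves $v$. Loop property: there are no parallel arcs connecting symmetric nodes (i.e. no arc from a node $v$ to $v'$). Notation: $\delta^{\rm in}(X)$, $\delta^{\rm out}(X)$, $\gamma(X)$ are the sets of arcs entering $X$, leaving $X$, having both ends in $X$. A bud in $G$ is a pair $\tau=(V_\tau,a_\tau)$ with $V_\tau$ a self-symmetric node set and $a_\tau\in\delta^{\rm in}(V_\tau)$ with head $v_\tau$, such that every node of $V_\tau$ is reachable from $v_\tau$ by a regular path in $G[V_\tau]$. Trimming $\tau$ transforms $G$ into the skew-symmetric graph $G/\tau$: remove all nodes of $V_\tau\setminus\{v_\tau,v_\tau'\}$ and all arcs of $\gamma(V_\tau)$; redirect the arcs of $\delta^{\rm in}(V_\tau)\setminus\{a_\tau\}$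 to enter $v_\tau'$ (tails unchanged); redirect the arcs of $\delta^{\rm out}(V_\tau)\setminus\{a_\tau'\}$ to leave $v_\tau$ (heads unchanged). Each arc not in $\gamma(V_\tau)$ has an image in $G/\tau$. Algorithm Acyclicity-Test. It maintains a current skew-symmetric graph $H$ (initially $G$), a directed forest $F$ in $H$ (initially empty), and node colors white, gray, black, antigray, antiblack; $v$ is white iff $v'$ is white, gray iff $v'$ is antigray, black iff $v'$ is antiblack. Initially all nodes are white. While there is a symmetric pair $\{v,v'\}$ of white nodes, choose such a pair, named so that the out-degree of $v$ is at most 1, and call the recursive procedure below at $v$ with no arc. If all calls complete normally, the algorithm terminates reporting no regular cycle. Recursive procedure with argument a node $u$ and optionally an arc $q$ entering $u$: mark $u$ gray (and $u'$ antigray) and add $u$ (and $q$, if given) to $F$. Then scan all arcs leaving $u$ in the current graph, including arcs that come to leave $u$ through trimmings made during the scan. For a scanned arc $a$ with head $v$ (in the current graph): (i) if $v$ is gray, the whole algorithm halts and reports the existence of a regular cycle; (ii) if $v$ is white, make a recursive call with parameters $(v,a)$; (iii) if $v$ is antiblack, then $u$ is a non-root node of $F$ and $v'$ is a descendant of $u$ in $F$; let $P$ be the $u$--$v'$ path in $F$, $V_\tau$ the union of the node sets of $P$ and $P'$, and $a_\tau$ the unique arc of $F$ entering $u$; then $\tau=(V_\tau,a_\tau)$ is a bud in $H$ with base node $u$. Replace $H$ by $H/\tau$, remove from $F$ the nodes of $V_\tau\setminus\{u,u'\}$ and the arcs of $\gamma(V_\tau)$, and replace all other arcs of $F$ by their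 images; (iv) otherwise skip $a$. When all arcs leaving $u$ are processed, mark $u$ black and $u'$ antiblack and return. *)

theory Defs
  imports "Graph_Theory.Graph_Theory"
begin

text \<open>
  The involution on nodes and arcs is split into its two parts \<open>\<sigma>\<^sub>V\<close> and \<open>\<sigma>\<^sub>A\<close>, both total functions
  whose values matter only on the nodes and arcs of the graph. Multiple arcs and loops at a node
  are allowed. Paths and circuits are \<open>apath\<close> and \<open>cycle\<close> of the library; a loop
  is a \<open>cycle\<close> of length 1.
\<close>

locale skew_symmetric_graph = fin_digraph G
  for G :: "('a, 'b) pre_digraph" +
  fixes \<sigma>\<^sub>V :: "'a \<Rightarrow> 'a" and \<sigma>\<^sub>A :: "'b \<Rightarrow> 'b"
  assumes node_mate_in: "v \<in> verts G \<Longrightarrow> \<sigma>\<^sub>V v \<in> verts G"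
    and node_mate_mate: "v \<in> verts G \<Longrightarrow> \<sigma>\<^sub>V (\<sigma>\<^sub>V v) = v"
    and node_mate_neq: "v \<in> verts G \<Longrightarrow> \<sigma>\<^sub>V v \<noteq> v"
    and arc_mate_in: "a \<in> arcs G \<Longrightarrow> \<sigma>\<^sub>A a \<in> arcs G"
    and arc_mate_mate: "a \<in> arcs G \<Longrightarrow> \<sigma>\<^sub>A (\<sigma>\<^sub>A a) = a"
    and arc_mate_neq: "a \<in> arcs G \<Longrightarrow> \<sigma>\<^sub>A a \<noteq> a"
    and tail_mate: "a \<in> arcs G \<Longrightarrow> tail G (\<sigma>\<^sub>A a) = \<sigma>\<^sub>V (head G a)"
    and head_mate: "a \<in> arcs G \<Longrightarrow> head G (\<sigma>\<^sub>A a) = \<sigma>\<^sub>V (tail G a)"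

definition regular :: "('b \<Rightarrow> 'b) \<Rightarrow> 'b awalk \<Rightarrow> bool" where
  "regular \<sigma>\<^sub>A p \<longleftrightarrow> (\<forall>a \<in> set p. \<sigma>\<^sub>A a \<notin> set p)"

definition weakly_acyclic :: "('b \<Rightarrow> 'b) \<Rightarrow> ('a, 'b) pre_digraph \<Rightarrow> bool" where
  "weakly_acyclic \<sigma>\<^sub>A G \<longleftrightarrow> \<not> (\<exists>p. pre_digraph.cycle G p \<and> regular \<sigma>\<^sub>A p)"

definition degree_property :: "('a, 'b) pre_digraph \<Rightarrow> bool" where
  "degree_property G \<longleftrightarrow> (\<forall>v \<in> verts G. in_degree G v \<le> 1 \<or> out_degree G v \<le> 1)"

definition loop_property :: "('a \<Rightarrow> 'a) \<Rightarrow> ('a, 'b) pre_digraph \<Rightarrow> bool" where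
  "loop_property \<sigma>\<^sub>V G \<longleftrightarrow> (\<forall>a \<in> arcs G. head G a \<noteq> \<sigma>\<^sub>V (tail G a))"

definition entering :: "('a, 'b) pre_digraph \<Rightarrow> 'a set \<Rightarrow> 'b set" where
  "entering G X = {a \<in> arcs G. tail G a \<notin> X \<and> head G a \<in> X}"

definition leaving :: "('a, 'b) pre_digraph \<Rightarrow> 'a set \<Rightarrow> 'b set" where
  "leaving G X = {a \<in> arcs G. tail G a \<in> X \<and> head G a \<notin> X}"

definition inside :: "('a, 'b) pre_digraph \<Rightarrow> 'a set \<Rightarrow> 'b set" where
  "inside G X = {a \<in> arcs G. tail G a \<in> X \<and> head G a \<in> X}"

definition bud ::
  "('a \<Rightarrow> 'a) \<Rightarrow> ('b \<Rightarrow> 'b) \<Rightarrow> ('a, 'b) pre_digraph \<Rightarrow> 'a set \<Rightarrow> 'b \<Rightarrow> bool" where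
  "bud \<sigma>\<^sub>V \<sigma>\<^sub>A G X a \<longleftrightarrow>
     X \<subseteq> verts G \<and> \<sigma>\<^sub>V ` X = X \<and> a \<in> entering G X \<and>
     (\<forall>x \<in> X. \<exists>p. pre_digraph.apath (G \<restriction> X) (head G a) p x \<and> regular \<sigma>\<^sub>A p)"

text \<open>
  The trimmed graph \<open>G/(X, a)\<close>. An arc not inside \<open>X\<close> and its image are the same element of type
  \<open>'b\<close>, only its ends may change; the involution of the trimmed graph is therefore given by the
  same \<open>\<sigma>\<^sub>V\<close> and \<open>\<sigma>\<^sub>A\<close>.
\<close>

definition trim ::
  "('a \<Rightarrow> 'a) \<Rightarrow> ('b \<Rightarrow> 'b) \<Rightarrow> ('a, 'b) pre_digraph \<Rightarrow> 'a set \<Rightarrow> 'b \<Rightarrow> ('a, 'b) pre_digraph" where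
  "trim \<sigma>\<^sub>V \<sigma>\<^sub>A G X a =
     \<lparr> verts = verts G - (X - {head G a, \<sigma>\<^sub>V (head G a)}),
       arcs = arcs G - inside G X,
       tail = (\<lambda>b. if b \<in> leaving G X - {\<sigma>\<^sub>A a} then head G a else tail G b),
       head = (\<lambda>b. if b \<in> entering G X - {a} then \<sigma>\<^sub>V (head G a) else head G b) \<rparr>"

datatype colour = White | Gray | Black | Antigray | Antiblack

datatype report = No_Regular_Cycle | Regular_Cycle

text \<open>
  The recursion is made explicit by a stack, innermost call first. A call is represented by its node
  together with the set of arcs it has scanned so far, so an arc redirected by a trimming
  to leave the node of the call is scanned by that call even if
  an earlier call has scanned it, and no call scans an arc twice.
\<close>

record ('a, 'b) state =
  cur_graph :: "('a, 'b) pre_digraph"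
  forest_nodes :: "'a set"
  forest_arcs :: "'b set"
  col :: "'a \<Rightarrow> colour"
  stack :: "('a \<times> 'b set) list"

datatype ('a, 'b) config = Running "('a, 'b) state" | Halted report

definition forest_graph :: "('a, 'b) state \<Rightarrow> ('a, 'b) pre_digraph" where
  "forest_graph s =
     \<lparr> verts = forest_nodes s, arcs = forest_arcs s, tail = tail (cur_graph s), head = head (cur_graph s) \<rparr>"

definition init_config :: "('a, 'b) pre_digraph \<Rightarrow> ('a, 'b) config" where
  "init_config G = Running
     \<lparr> cur_graph = G, forest_nodes = {}, forest_arcs = {}, col = (\<lambda>_. White), stack = [] \<rparr>"

definition enter_call ::
  "('a \<Rightarrow> 'a) \<Rightarrow> 'a \<Rightarrow> 'b option \<Rightarrow> ('a, 'b) state \<Rightarrow> ('a, 'b) state" where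
  "enter_call \<sigma>\<^sub>V u q s = s
     \<lparr> forest_nodes := insert u (forest_nodes s),
       forest_arcs := forest_arcs s \<union> set_option q,
       col := (col s)(u := Gray, \<sigma>\<^sub>V u := Antigray),
       stack := (u, {}) # stack s \<rparr>"

definition trim_state ::
  "('a \<Rightarrow> 'a) \<Rightarrow> ('b \<Rightarrow> 'b) \<Rightarrow> 'a \<Rightarrow> 'a set \<Rightarrow> 'b \<Rightarrow> ('a, 'b) state \<Rightarrow> ('a, 'b) state" where
  "trim_state \<sigma>\<^sub>V \<sigma>\<^sub>A u X a s = s
     \<lparr> cur_graph := trim \<sigma>\<^sub>V \<sigma>\<^sub>A (cur_graph s) X a,
       forest_nodes := forest_nodes s - (X - {u, \<sigma>\<^sub>V u}),
       forest_arcs := forest_arcs s - inside (cur_graph s) X \<rparr>"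

text \<open>
  The relation is nondeterministic in the choice of the white pair and in the order of
  scanning. In rule \<open>scan_antiblack\<close>, the assertions that \<open>u\<close> is not a root, that \<open>\<sigma>\<^sub>V v\<close> is a
  descendant of \<open>u\<close> and that a bud arises are premises: if one of them
  failed, the execution would be stuck in a \<open>Running\<close> configuration, without a report.
\<close>

inductive step ::
  "('a \<Rightarrow> 'a) \<Rightarrow> ('b \<Rightarrow> 'b) \<Rightarrow> ('a, 'b) config \<Rightarrow> ('a, 'b) config \<Rightarrow> bool"
  for \<sigma>\<^sub>V :: "'a \<Rightarrow> 'a" and \<sigma>\<^sub>A :: "'b \<Rightarrow> 'b"
where
  start:
    "\<lbrakk> stack s = []; v \<in> verts (cur_graph s); col s v = White; col s (\<sigma>\<^sub>V v) = White;
       out_degree (cur_graph s) v \<le> 1 \<rbrakk>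
     \<Longrightarrow> step \<sigma>\<^sub>V \<sigma>\<^sub>A (Running s) (Running (enter_call \<sigma>\<^sub>V v None s))"
| finish:
    "\<lbrakk> stack s = []; \<not> (\<exists>v \<in> verts (cur_graph s). col s v = White \<and> col s (\<sigma>\<^sub>V v) = White) \<rbrakk>
     \<Longrightarrow> step \<sigma>\<^sub>V \<sigma>\<^sub>A (Running s) (Halted No_Regular_Cycle)"
| scan_gray:
    "\<lbrakk> stack s = (u, S) # cs; a \<in> out_arcs (cur_graph s) u - S; col s (head (cur_graph s) a) = Gray \<rbrakk>
     \<Longrightarrow> step \<sigma>\<^sub>V \<sigma>\<^sub>A (Running s) (Halted Regular_Cycle)"
| scan_white:
    "\<lbrakk> stack s = (u, S) # cs; a \<in> out_arcs (cur_graph s) u - S;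
       v = head (cur_graph s) a; col s v = White \<rbrakk>
     \<Longrightarrow> step \<sigma>\<^sub>V \<sigma>\<^sub>A (Running s)
           (Running (enter_call \<sigma>\<^sub>V v (Some a) (s\<lparr> stack := (u, insert a S) # cs \<rparr>)))"
| scan_antiblack:
    "\<lbrakk> stack s = (u, S) # cs; a \<in> out_arcs (cur_graph s) u - S;
       v = head (cur_graph s) a; col s v = Antiblack;
       pre_digraph.apath (forest_graph s) u p (\<sigma>\<^sub>V v);
       P = set (pre_digraph.awalk_verts (forest_graph s) u p);
       X = P \<union> \<sigma>\<^sub>V ` P;
       in_arcs (forest_graph s) u = {b};
       bud \<sigma>\<^sub>V \<sigma>\<^sub>A (cur_graph s) X b \<rbrakk>
     \<Longrightarrow> step \<sigma>\<^sub>V \<sigma>\<^sub>A (Running s)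
           (Running (trim_state \<sigma>\<^sub>V \<sigma>\<^sub>A u X b (s\<lparr> stack := (u, insert a S) # cs \<rparr>)))"
| scan_skip:
    "\<lbrakk> stack s = (u, S) # cs; a \<in> out_arcs (cur_graph s) u - S;
       col s (head (cur_graph s) a) \<in> {Black, Antigray} \<rbrakk>
     \<Longrightarrow> step \<sigma>\<^sub>V \<sigma>\<^sub>A (Running s) (Running (s\<lparr> stack := (u, insert a S) # cs \<rparr>))"
| return:
    "\<lbrakk> stack s = (u, S) # cs; out_arcs (cur_graph s) u \<subseteq> S \<rbrakk>
     \<Longrightarrow> step \<sigma>\<^sub>V \<sigma>\<^sub>A (Running s)
           (Running (s\<lparr> col := (col s)(u := Black, \<sigma>\<^sub>V u := Antiblack), stack := cs \<rparr>))"

text \<open>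
  Every execution of Acyclicity-Test on \<open>G\<close>, however its choices are made, terminates and does so
  with the report \<open>r\<close>.
\<close>

definition acyclicity_test_reports ::
  "('a \<Rightarrow> 'a) \<Rightarrow> ('b \<Rightarrow> 'b) \<Rightarrow> ('a, 'b) pre_digraph \<Rightarrow> report \<Rightarrow> bool" where
  "acyclicity_test_reports \<sigma>\<^sub>V \<sigma>\<^sub>A G r \<longleftrightarrow>
     \<not> (\<exists>f. f 0 = init_config G \<and> (\<forall>i::nat. step \<sigma>\<^sub>V \<sigma>\<^sub>A (f i) (f (Suc i)))) \<and>
     (\<forall>c. (step \<sigma>\<^sub>V \<sigma>\<^sub>A)\<^sup>*\<^sup>* (init_config G) c \<and> \<not> (\<exists>d. step \<sigma>\<^sub>V \<sigma>\<^sub>A c d) \<longrightarrow> c = Halted r)"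

end

theory Submission
  imports Defs
begin

text \<open>
  Regular circuits are handled through their arc sets: a graph is not weakly acyclic iff it has a
  nonempty set of arcs, free of pairs of mates, in which every arc has a successor and a
  predecessor. Each trimming of the test preserves weak acyclicity in both directions. A regular
  circuit of the trimmed graph lifts through any bud. Conversely, a regular circuit that the
  trimming destroys leaves the blossom at a black node (up to mates) and then runs through
  black nodes of decreasing rank to the mate of a gray node; there the degree property forces it
  to follow mates of arcs of the search path, which yields a regular circuit in the trimmed
  graph. If all nodes end up black or antiblack, arcs leaving a black node lead to black nodes of
  smaller rank and the final graph is acyclic, whereas an arc scanned with a gray head closes a
  circuit of gray and black nodes, which is regular.
\<close>

section \<open>Circulations\<close>

text \<open>For an arbitrary bud a trimming can destroy regular circuits: an entering arc other than
  that of the bud is moved to the mate of the base and a leaving arc to the base, so a circuit that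
  crosses the node set without using the base is torn open. That this does no harm here depends on
  the state of the search. Preservation is therefore proved under the full invariant of the search,
  and the degree property, the loop property and the out-degree bound at the root must themselves
  survive each trimming.

  Arc sets keep the surgery simple. An arc and its image under trimming are the same element, so
  pieces of a circuit in one graph are literally arc sets of the other; pieces may be glued without
  regard to repeated nodes, because a simple circuit is extracted only at the very end. Since the
  involution reverses arcs, a circuit may also be exchanged for its mate.

  The ranks are no part of the state of the test. They are a witness in the invariant and encode at
  once ancestry in the forest and the order in which nodes turned black.\<close>

definition arc_rel :: "('a, 'b) pre_digraph \<Rightarrow> 'b set \<Rightarrow> 'a rel" where
  "arc_rel G A = (\<lambda>a. (tail G a, head G a)) ` A"

definition mate_free :: "('b \<Rightarrow> 'b) \<Rightarrow> 'b set \<Rightarrow> bool" where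
  "mate_free \<sigma>\<^sub>A A \<longleftrightarrow> (\<forall>a \<in> A. \<sigma>\<^sub>A a \<notin> A)"

text \<open>Both a successor and a predecessor are demanded so that the notion is self-dual under
  the involution, which reverses arcs. Neither connectedness nor simplicity is imposed.\<close>

definition circulation :: "('b \<Rightarrow> 'b) \<Rightarrow> ('a, 'b) pre_digraph \<Rightarrow> 'b set \<Rightarrow> bool" where
  "circulation \<sigma>\<^sub>A G A \<longleftrightarrow>
     A \<subseteq> arcs G \<and> A \<noteq> {} \<and> mate_free \<sigma>\<^sub>A A \<and>
     (\<forall>a \<in> A. \<exists>c \<in> A. tail G c = head G a) \<and> (\<forall>a \<in> A. \<exists>c \<in> A. head G c = tail G a)"

lemma arc_relI: "a \<in> A \<Longrightarrow> (tail G a, head G a) \<in> arc_rel G A"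
  by (simp add: arc_rel_def)

lemma arc_relI': "a \<in> A \<Longrightarrow> tail G a = x \<Longrightarrow> head G a = y \<Longrightarrow> (x, y) \<in> arc_rel G A"
  by (auto simp: arc_rel_def)

lemma arc_relE:
  assumes "(x, y) \<in> arc_rel G A"
  obtains a where "a \<in> A" "tail G a = x" "head G a = y"
  using assms by (auto simp: arc_rel_def)

lemma arc_rel_mono: "A \<subseteq> B \<Longrightarrow> arc_rel G A \<subseteq> arc_rel G B"
  by (auto simp: arc_rel_def)

lemma mate_free_subset: "mate_free \<sigma>\<^sub>A B \<Longrightarrow> A \<subseteq> B \<Longrightarrow> mate_free \<sigma>\<^sub>A A"
  by (auto simp: mate_free_def)

lemma regular_iff_mate_free: "regular \<sigma>\<^sub>A p \<longleftrightarrow> mate_free \<sigma>\<^sub>A (set p)"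
  by (simp add: regular_def mate_free_def)

text \<open>In the subgraph with arc set \<open>A\<close> the relation yields a closed walk, from
  which a simple cycle is extracted. Its arcs stay in \<open>A\<close>, and mate-freeness is
  inherited by subsets.\<close>

lemma (in wf_digraph) not_weakly_acyclicI:
  assumes A: "A \<subseteq> arcs G" and free: "mate_free \<sigma>\<^sub>A A" and cyc: "(x, x) \<in> (arc_rel G A)\<^sup>+"
  shows "\<not> weakly_acyclic \<sigma>\<^sub>A G"
proof -
  let ?H = "G\<lparr>arcs := A\<rparr>"
  interpret H: wf_digraph ?H
    using A by unfold_locales auto
  have "arcs_ends ?H = arc_rel G A"
    by (simp add: arcs_ends_conv arc_rel_def)
  with cyc have "x \<rightarrow>\<^sup>+\<^bsub>?H\<^esub> x" by simp
  then obtain p where "H.awalk x p x" "p \<noteq> []"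
    using H.reachable1_awalk by blast
  then have "H.closed_w p"
    by (auto simp: H.closed_w_def)
  then obtain q where q: "H.cycle q"
    using H.closed_w_imp_cycle by blast
  then have qA: "set q \<subseteq> A"
    by (auto simp: H.cycle_def H.awalk_def)
  have "subgraph ?H G"
    using A wf_digraph H.wf_digraph by (auto simp: subgraph_def compatible_def)
  then have "cycle q"
    using q by (rule subgraph_cycle)
  moreover have "regular \<sigma>\<^sub>A q"
    using mate_free_subset[OF free qA] by (simp add: regular_iff_mate_free)
  ultimately show ?thesis
    by (auto simp: weakly_acyclic_def)
qed

text \<open>Otherwise the finite relation is acyclic and its converse well-founded; a minimal
  element among the heads of \<open>A\<close> would then have no successor in
  \<open>A\<close>.\<close>

lemma successor_closed_imp_trancl:
  assumes "finite A" "A \<noteq> {}" and succ: "\<And>a. a \<in> A \<Longrightarrow> \<exists>c \<in> A. tail G c = head G a"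
  shows "\<exists>x. (x, x) \<in> (arc_rel G A)\<^sup>+"
proof (rule ccontr)
  assume "\<not> ?thesis"
  then have "acyclic (arc_rel G A)"
    by (auto simp: acyclic_def)
  moreover have "finite (arc_rel G A)"
    using \<open>finite A\<close> by (simp add: arc_rel_def)
  ultimately have wf: "wf ((arc_rel G A)\<inverse>)"
    by (rule finite_acyclic_wf_converse[rotated])
  obtain a where "a \<in> A" using \<open>A \<noteq> {}\<close> by blast
  then have "head G a \<in> head G ` A" by blast
  then obtain z where "z \<in> head G ` A" and
    z: "\<And>y. (y, z) \<in> (arc_rel G A)\<inverse> \<Longrightarrow> y \<notin> head G ` A"
    using wf by (metis wfE_min)
  then obtain c where "c \<in> A" "tail G c = z"
    using succ by blast
  then show False
    using z[of "head G c"] by (auto simp: arc_rel_def)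
qed

lemma (in fin_digraph) successor_closed_imp_not_weakly_acyclic:
  assumes "A \<subseteq> arcs G" "A \<noteq> {}" "mate_free \<sigma>\<^sub>A A"
    and "\<And>a. a \<in> A \<Longrightarrow> \<exists>c \<in> A. tail G c = head G a"
  shows "\<not> weakly_acyclic \<sigma>\<^sub>A G"
proof -
  have "finite A"
    using finite_subset[OF assms(1)] by simp
  then obtain x where "(x, x) \<in> (arc_rel G A)\<^sup>+"
    using successor_closed_imp_trancl assms(2,4) by metis
  then show ?thesis
    using not_weakly_acyclicI assms(1,3) by metis
qed

lemma (in pre_digraph) cas_successor:
  "cas u p v \<Longrightarrow> a \<in> set p \<Longrightarrow> head G a = v \<or> (\<exists>c \<in> set p. tail G c = head G a)"
proof (induction p arbitrary: u)
  case (Cons e p)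
  then show ?case by (cases p) auto
qed simp

lemma (in pre_digraph) cas_predecessor:
  "cas u p v \<Longrightarrow> a \<in> set p \<Longrightarrow> tail G a = u \<or> (\<exists>c \<in> set p. head G c = tail G a)"
  by (induction p arbitrary: u) auto

lemma (in pre_digraph) cas_tail_start: "cas u p v \<Longrightarrow> p \<noteq> [] \<Longrightarrow> \<exists>a \<in> set p. tail G a = u"
  by (cases p) auto

lemma (in pre_digraph) cas_head_end: "cas u p v \<Longrightarrow> p \<noteq> [] \<Longrightarrow> \<exists>a \<in> set p. head G a = v"
  by (induction p arbitrary: u) (auto split: if_splits, metis cas.simps(1) list.exhaust)

lemma (in wf_digraph) not_weakly_acyclicE:
  assumes "\<not> weakly_acyclic \<sigma>\<^sub>A G"
  obtains A where "circulation \<sigma>\<^sub>A G A"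
proof -
  from assms obtain p u where p: "awalk u p u" "p \<noteq> []" "regular \<sigma>\<^sub>A p"
    by (auto simp: weakly_acyclic_def cycle_def)
  then have "cas u p u" "set p \<subseteq> arcs G" by auto
  with p have "circulation \<sigma>\<^sub>A G (set p)"
    unfolding circulation_def regular_iff_mate_free
    by (metis cas_head_end cas_predecessor cas_successor cas_tail_start set_empty)
  then show thesis by (rule that)
qed

context skew_symmetric_graph
begin

lemma mate_free_image:
  assumes "A \<subseteq> arcs G" "mate_free \<sigma>\<^sub>A A"
  shows "mate_free \<sigma>\<^sub>A (\<sigma>\<^sub>A ` A)"
  using assms arc_mate_mate unfolding mate_free_def by (metis (no_types, lifting) imageE subsetD)

text \<open>The involution exchanges successors with predecessors. This permits passing to the mate
  of a circuit whenever that one is more convenient.\<close>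

lemma circulation_mate:
  assumes "circulation \<sigma>\<^sub>A G A"
  shows "circulation \<sigma>\<^sub>A G (\<sigma>\<^sub>A ` A)"
proof -
  from assms have A: "A \<subseteq> arcs G" "A \<noteq> {}" "mate_free \<sigma>\<^sub>A A"
    and succ: "\<And>a. a \<in> A \<Longrightarrow> \<exists>c \<in> A. tail G c = head G a"
    and pred: "\<And>a. a \<in> A \<Longrightarrow> \<exists>c \<in> A. head G c = tail G a"
    by (auto simp: circulation_def)
  show ?thesis
    unfolding circulation_def
  proof (intro conjI ballI)
    show "\<sigma>\<^sub>A ` A \<subseteq> arcs G" "\<sigma>\<^sub>A ` A \<noteq> {}"
      using A arc_mate_in by auto
    show "mate_free \<sigma>\<^sub>A (\<sigma>\<^sub>A ` A)"
      using mate_free_image A by blast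
    fix c assume "c \<in> \<sigma>\<^sub>A ` A"
    then obtain a where a: "a \<in> A" "c = \<sigma>\<^sub>A a" by blast
    with pred obtain d where d: "d \<in> A" "head G d = tail G a" by blast
    show "\<exists>d \<in> \<sigma>\<^sub>A ` A. tail G d = head G c"
      using a d A by (intro bexI[of _ "\<sigma>\<^sub>A d"]) (auto simp: tail_mate head_mate subset_iff)
    from a succ obtain e where e: "e \<in> A" "tail G e = head G a" by blast
    show "\<exists>d \<in> \<sigma>\<^sub>A ` A. head G d = tail G c"
      using a e A by (intro bexI[of _ "\<sigma>\<^sub>A e"]) (auto simp: tail_mate head_mate subset_iff)
  qed
qed

lemma out_arcs_mate: "v \<in> verts G \<Longrightarrow> out_arcs G (\<sigma>\<^sub>V v) = \<sigma>\<^sub>A ` in_arcs G v"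
proof (intro equalityI subsetI)
  fix a assume v: "v \<in> verts G" and "a \<in> out_arcs G (\<sigma>\<^sub>V v)"
  then have "a = \<sigma>\<^sub>A (\<sigma>\<^sub>A a)" "\<sigma>\<^sub>A a \<in> in_arcs G v"
    by (auto simp: arc_mate_mate arc_mate_in head_mate node_mate_mate)
  then show "a \<in> \<sigma>\<^sub>A ` in_arcs G v" by blast
qed (auto simp: arc_mate_in tail_mate)

lemma inj_on_arc_mate: "inj_on \<sigma>\<^sub>A (arcs G)"
  by (metis arc_mate_mate inj_on_inverseI)

lemma out_degree_mate: "v \<in> verts G \<Longrightarrow> out_degree G (\<sigma>\<^sub>V v) = in_degree G v"
  unfolding out_degree_def in_degree_def out_arcs_mate
  by (rule card_image) (rule inj_on_subset[OF inj_on_arc_mate], auto)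

lemma node_mate_eq_iff: "v \<in> verts G \<Longrightarrow> w \<in> verts G \<Longrightarrow> \<sigma>\<^sub>V v = w \<longleftrightarrow> v = \<sigma>\<^sub>V w"
  using node_mate_mate by metis

end

section \<open>Trimming a bud\<close>

lemma (in pre_digraph) cas_imp_rtrancl:
  "cas u p v \<Longrightarrow> set p \<subseteq> A \<Longrightarrow> (u, v) \<in> (arc_rel G A)\<^sup>*"
proof (induction p arbitrary: u)
  case (Cons e p)
  then have "(u, head G e) \<in> arc_rel G A" "(head G e, v) \<in> (arc_rel G A)\<^sup>*"
    by (auto simp: arc_rel_def)
  then show ?case by (rule converse_rtrancl_into_rtrancl)
qed simp

lemma trancl_subset_trancl:
  assumes "R \<subseteq> S\<^sup>+"
  shows "R\<^sup>+ \<subseteq> S\<^sup>+"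
proof -
  have "(x, y) \<in> S\<^sup>+" if "(x, y) \<in> R\<^sup>+" for x y
    using that
  proof (induction rule: trancl_induct)
    case (step y z)
    then show ?case using assms by (meson subsetD trancl_trans)
  qed (use assms in blast)
  then show ?thesis by auto
qed

locale bud_trimming = skew_symmetric_graph G \<sigma>\<^sub>V \<sigma>\<^sub>A
  for G :: "('a, 'b) pre_digraph" and \<sigma>\<^sub>V :: "'a \<Rightarrow> 'a" and \<sigma>\<^sub>A :: "'b \<Rightarrow> 'b" +
  fixes X :: "'a set" and b :: 'b
  assumes bud: "bud \<sigma>\<^sub>V \<sigma>\<^sub>A G X b"
begin

abbreviation base :: 'a where "base \<equiv> head G b"

abbreviation trimmed :: "('a, 'b) pre_digraph" where "trimmed \<equiv> trim \<sigma>\<^sub>V \<sigma>\<^sub>A G X b"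

lemma X_verts: "x \<in> X \<Longrightarrow> x \<in> verts G"
  and X_mate: "x \<in> X \<Longrightarrow> \<sigma>\<^sub>V x \<in> X"
  and b_arc: "b \<in> arcs G"
  and tail_b: "tail G b \<notin> X"
  and base_in: "base \<in> X"
  using bud by (auto simp: bud_def entering_def)

lemma X_mate_iff: "x \<in> verts G \<Longrightarrow> \<sigma>\<^sub>V x \<in> X \<longleftrightarrow> x \<in> X"
  using X_mate node_mate_mate by metis

lemma base_neq_mate: "base \<noteq> \<sigma>\<^sub>V base" "\<sigma>\<^sub>V base \<noteq> base"
  using node_mate_neq[OF X_verts[OF base_in]] by auto

lemma mate_b: "\<sigma>\<^sub>A b \<in> arcs G" "tail G (\<sigma>\<^sub>A b) = \<sigma>\<^sub>V base" "head G (\<sigma>\<^sub>A b) \<notin> X"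
  using arc_mate_in[OF b_arc] tail_mate[OF b_arc] head_mate[OF b_arc] tail_b
  by (auto simp: X_mate_iff b_arc)

lemma verts_trim: "verts trimmed = verts G - (X - {base, \<sigma>\<^sub>V base})"
  by (simp add: trim_def)

lemma arcs_trim: "a \<in> arcs trimmed \<longleftrightarrow> a \<in> arcs G \<and> \<not> (tail G a \<in> X \<and> head G a \<in> X)"
  by (auto simp: trim_def inside_def)

lemma tail_trim: "a \<in> arcs trimmed \<Longrightarrow>
    tail trimmed a = (if tail G a \<in> X \<and> a \<noteq> \<sigma>\<^sub>A b then base else tail G a)"
  by (auto simp: trim_def inside_def leaving_def)

lemma head_trim: "a \<in> arcs trimmed \<Longrightarrow>
    head trimmed a = (if head G a \<in> X \<and> a \<noteq> b then \<sigma>\<^sub>V base else head G a)"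
  by (auto simp: trim_def inside_def entering_def)

lemma b_trimmed: "b \<in> arcs trimmed" "tail trimmed b = tail G b" "head trimmed b = base"
  using b_arc tail_b by (auto simp: arcs_trim tail_trim head_trim)

lemma mate_b_trimmed: "\<sigma>\<^sub>A b \<in> arcs trimmed" "tail trimmed (\<sigma>\<^sub>A b) = \<sigma>\<^sub>V base"
  "head trimmed (\<sigma>\<^sub>A b) = \<sigma>\<^sub>V (tail G b)"
  using mate_b b_arc head_mate[OF b_arc] by (auto simp: arcs_trim tail_trim head_trim)

lemma base_trimmed: "base \<in> verts trimmed" "\<sigma>\<^sub>V base \<in> verts trimmed"
  using base_in X_verts X_mate by (auto simp: verts_trim)

lemma skew_symmetric_trimmed: "skew_symmetric_graph trimmed \<sigma>\<^sub>V \<sigma>\<^sub>A"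
proof
  fix a assume a: "a \<in> arcs trimmed"
  then have aG: "a \<in> arcs G" by (simp add: arcs_trim)
  then show m: "\<sigma>\<^sub>A a \<in> arcs trimmed"
    using a by (auto simp: arcs_trim arc_mate_in tail_mate head_mate X_mate_iff)
  show "tail trimmed a \<in> verts trimmed" "head trimmed a \<in> verts trimmed"
    using a aG base_trimmed mate_b_trimmed
    by (auto simp: tail_trim head_trim arcs_trim verts_trim mate_b)
  \<comment> \<open>\<open>b\<close> and its mate are exempt from redirection, one in the clause for
    heads and the other in the clause for tails; the two equivalences match these exceptions under
    the involution.\<close>
  have "\<sigma>\<^sub>A a = b \<longleftrightarrow> a = \<sigma>\<^sub>A b"
    using aG b_arc arc_mate_mate by metis
  moreover have "\<sigma>\<^sub>A a = \<sigma>\<^sub>A b \<longleftrightarrow> a = b"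
    using aG b_arc arc_mate_mate by metis
  moreover have "\<sigma>\<^sub>V (\<sigma>\<^sub>V base) = base"
    using node_mate_mate X_verts base_in by blast
  ultimately show "tail trimmed (\<sigma>\<^sub>A a) = \<sigma>\<^sub>V (head trimmed a)"
    "head trimmed (\<sigma>\<^sub>A a) = \<sigma>\<^sub>V (tail trimmed a)"
    using a m aG by (auto simp: tail_trim head_trim tail_mate head_mate X_mate_iff)
  show "\<sigma>\<^sub>A (\<sigma>\<^sub>A a) = a" "\<sigma>\<^sub>A a \<noteq> a"
    using aG by (simp_all add: arc_mate_mate arc_mate_neq)
next
  fix v assume "v \<in> verts trimmed"
  then show "\<sigma>\<^sub>V v \<in> verts trimmed" "\<sigma>\<^sub>V (\<sigma>\<^sub>V v) = v" "\<sigma>\<^sub>V v \<noteq> v"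
    using base_in X_verts
    by (auto simp: verts_trim node_mate_in node_mate_mate node_mate_neq X_mate_iff node_mate_eq_iff)
qed (auto simp: verts_trim trim_def)

lemma in_arcs_trimmed_base: "in_arcs trimmed base = {b}"
  using b_trimmed base_in base_neq_mate
  by (auto simp: in_arcs_def head_trim split: if_splits)

lemma out_arcs_trimmed: "v \<notin> X \<Longrightarrow> out_arcs trimmed v = out_arcs G v"
  using base_in by (auto simp: out_arcs_def tail_trim arcs_trim split: if_splits)

lemma in_arcs_trimmed: "v \<notin> X \<Longrightarrow> in_arcs trimmed v = in_arcs G v"
  using X_mate[OF base_in] by (auto simp: in_arcs_def head_trim arcs_trim split: if_splits)

text \<open>Only \<open>b\<close> enters the base after the trimming and only its mate leaves the
  mate of the base; nodes outside \<open>X\<close> keep their sets of entering and leaving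
  arcs.\<close>

lemma degree_property_trimmed:
  assumes "degree_property G"
  shows "degree_property trimmed"
  unfolding degree_property_def
proof
  fix v assume v: "v \<in> verts trimmed"
  interpret T: skew_symmetric_graph trimmed \<sigma>\<^sub>V \<sigma>\<^sub>A by (rule skew_symmetric_trimmed)
  have 1: "in_degree trimmed base = 1"
    by (simp add: in_degree_def in_arcs_trimmed_base)
  consider "v = base" | "v = \<sigma>\<^sub>V base" | "v \<in> verts G" "v \<notin> X"
    using v by (auto simp: verts_trim)
  then show "in_degree trimmed v \<le> 1 \<or> out_degree trimmed v \<le> 1"
  proof cases
    case 2
    then show ?thesis using 1 T.out_degree_mate[OF base_trimmed(1)] by simp
  qed (use 1 assms in \<open>auto simp: degree_property_def in_degree_def out_degree_def
      in_arcs_trimmed out_arcs_trimmed\<close>)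
qed

text \<open>An arc between symmetric nodes has both or none of its ends in the self-symmetric set
  \<open>X\<close>. Redirection moves ends only within \<open>X\<close> and the arcs inside
  \<open>X\<close> are gone, so no such arc can arise.\<close>

lemma loop_property_trimmed:
  assumes "loop_property \<sigma>\<^sub>V G"
  shows "loop_property \<sigma>\<^sub>V trimmed"
  unfolding loop_property_def
proof
  fix a assume a: "a \<in> arcs trimmed"
  then have aG: "a \<in> arcs G" and "\<not> (tail G a \<in> X \<and> head G a \<in> X)"
    by (auto simp: arcs_trim)
  moreover have "head G a \<noteq> \<sigma>\<^sub>V (tail G a)"
    using assms aG by (auto simp: loop_property_def)
  ultimately show "head trimmed a \<noteq> \<sigma>\<^sub>V (tail trimmed a)"
    using a base_in X_mate[of "tail G a"] X_mate[OF base_in] X_mate_iff[of "tail G a"]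
    by (simp add: head_trim tail_trim) (metis X_mate_iff X_verts tail_in_verts)
qed

text \<open>
  A circuit of the trimmed graph through the base node enters it through \<^term>\<open>b\<close>, so it
  avoids the mate of the base, and a regular path inside \<^term>\<open>X\<close> fills the gap.
\<close>

lemma lift_circulation_avoiding:
  assumes A: "circulation \<sigma>\<^sub>A trimmed A" and avoid: "\<And>a. a \<in> A \<Longrightarrow> head trimmed a \<noteq> \<sigma>\<^sub>V base"
  shows "\<not> weakly_acyclic \<sigma>\<^sub>A G"
proof -
  from A have sub: "A \<subseteq> arcs trimmed" and ne: "A \<noteq> {}" and free: "mate_free \<sigma>\<^sub>A A"
    and succ: "\<And>a. a \<in> A \<Longrightarrow> \<exists>c \<in> A. tail trimmed c = head trimmed a"
    by (auto simp: circulation_def)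
  have subG: "A \<subseteq> arcs G" using sub arcs_trim by blast
  have heads: "head trimmed a = head G a" if "a \<in> A" for a
    using avoid[OF that] that sub head_trim[of a] by (auto split: if_splits)
  have tails: "tail trimmed a = tail G a" if "a \<in> A" "tail trimmed a \<noteq> base" for a
    using that sub tail_trim[of a] by (auto split: if_splits)
  show ?thesis
  proof (cases "\<exists>f \<in> A. tail trimmed f = base")
    case False
    then have "\<exists>c \<in> A. tail G c = head G a" if "a \<in> A" for a
      using succ[OF that] heads tails that by metis
    then show ?thesis
      using successor_closed_imp_not_weakly_acyclic[OF subG ne free] by blast
  next
    case True
    then obtain f where f: "f \<in> A" "tail trimmed f = base" by blast
    then have "tail G f \<in> X"
      using sub base_in tail_trim[of f] by (auto split: if_splits)
    then obtain q where q: "pre_digraph.apath (G \<restriction> X) base q (tail G f)" "regular \<sigma>\<^sub>A q"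
      using bud by (auto simp: bud_def)
    then have q_arcs: "set q \<subseteq> inside G X" and q_cas: "cas base q (tail G f)"
      using compatible_cas[of G "G \<restriction> X"]
      by (auto simp: pre_digraph.apath_def pre_digraph.awalk_def inside_def compatible_def)
    \<comment> \<open>A single arc \<open>f\<close> is kept at the base, so that every passage
      through the base is filled by the same path \<open>q\<close>; two different fillings might
      contain mates of each other. The reduced set is still closed under successors.\<close>
    define B where "B = insert f {a \<in> A. tail trimmed a \<noteq> base}"
    have BA: "B \<subseteq> A" using f by (auto simp: B_def)
    have "\<exists>c \<in> B. tail trimmed c = head trimmed a" if "a \<in> B" for a
    proof -
      obtain c where "c \<in> A" "tail trimmed c = head trimmed a"
        using succ \<open>a \<in> B\<close> BA by blast
      then show ?thesis
        using f unfolding B_def by (cases "head trimmed a = base") force+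
    qed
    moreover have "finite B"
      using finite_subset[OF order.trans[OF BA subG]] by simp
    moreover have "B \<noteq> {}" by (simp add: B_def)
    ultimately obtain x where x: "(x, x) \<in> (arc_rel trimmed B)\<^sup>+"
      using successor_closed_imp_trancl by metis
    let ?C = "B \<union> set q"
    have step_f: "(base, head G f) \<in> (arc_rel G ?C)\<^sup>+"
    proof -
      have "(base, tail G f) \<in> (arc_rel G ?C)\<^sup>*"
        using q_cas by (rule cas_imp_rtrancl) simp
      moreover have "(tail G f, head G f) \<in> arc_rel G ?C"
        by (rule arc_relI) (simp add: B_def)
      ultimately show ?thesis by (rule rtrancl_into_trancl1)
    qed
    have "arc_rel trimmed B \<subseteq> (arc_rel G ?C)\<^sup>+"
    proof safe
      fix y z assume "(y, z) \<in> arc_rel trimmed B"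
      then obtain a where a: "a \<in> B" "tail trimmed a = y" "head trimmed a = z"
        by (rule arc_relE)
      show "(y, z) \<in> (arc_rel G ?C)\<^sup>+"
      proof (cases "a = f")
        case True
        then show ?thesis using step_f heads a f by auto
      next
        case False
        then have "tail G a = y" "head G a = z" "a \<in> ?C"
          using a heads tails BA by (auto simp: B_def)
        then show ?thesis by (intro r_into_trancl arc_relI'[of a])
      qed
    qed
    then have cyc: "(x, x) \<in> (arc_rel G ?C)\<^sup>+"
      using x trancl_subset_trancl by blast
    have "mate_free \<sigma>\<^sub>A ?C"
    proof -
      have "\<sigma>\<^sub>A a \<notin> inside G X" if "a \<in> A" for a
        using that sub subG tail_mate[of a] head_mate[of a] arcs_trim[of a]
        by (auto simp: inside_def X_mate_iff subset_iff)
      moreover have "\<sigma>\<^sub>A a \<in> inside G X" if "a \<in> inside G X" for a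
        using that by (auto simp: inside_def arc_mate_in tail_mate head_mate X_mate)
      moreover have "A \<inter> inside G X = {}"
        using sub by (auto simp: arcs_trim inside_def)
      ultimately show ?thesis
        using q(2) BA free q_arcs unfolding mate_free_def regular_def by blast
    qed
    moreover have "?C \<subseteq> arcs G"
      using BA subG q_arcs by (auto simp: inside_def)
    ultimately show ?thesis
      using not_weakly_acyclicI cyc by blast
  qed
qed

text \<open>The mate of the base has a single exit, the mate of \<open>b\<close>. A circulation that
  visits it therefore contains that arc and not \<open>b\<close>, so it never enters the base; its
  mate then avoids the mate of the base.\<close>

lemma lift_not_weakly_acyclic:
  assumes "\<not> weakly_acyclic \<sigma>\<^sub>A trimmed"
  shows "\<not> weakly_acyclic \<sigma>\<^sub>A G"
proof -
  interpret T: skew_symmetric_graph trimmed \<sigma>\<^sub>V \<sigma>\<^sub>A by (rule skew_symmetric_trimmed)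
  from assms obtain A where A: "circulation \<sigma>\<^sub>A trimmed A"
    by (rule T.not_weakly_acyclicE)
  show ?thesis
  proof (cases "\<exists>a \<in> A. head trimmed a = \<sigma>\<^sub>V base")
    case False
    then show ?thesis using lift_circulation_avoiding A by blast
  next
    case True
    have AT: "A \<subseteq> arcs trimmed" using A by (simp add: circulation_def)
    have "out_arcs trimmed (\<sigma>\<^sub>V base) = {\<sigma>\<^sub>A b}"
      using T.out_arcs_mate[OF base_trimmed(1)] by (simp add: in_arcs_trimmed_base)
    then have "\<sigma>\<^sub>A b \<in> A"
      using True A AT unfolding circulation_def by (metis in_mono in_out_arcs_conv singletonD)
    then have "b \<notin> A"
      using A by (auto simp: circulation_def mate_free_def)
    then have "head trimmed a \<noteq> base" if "a \<in> A" for a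
      using that AT in_arcs_trimmed_base by (metis in_mono in_in_arcs_conv singletonD)
    then have no_tail: "tail trimmed a \<noteq> base" if "a \<in> A" for a
      using that A unfolding circulation_def by metis
    have "head trimmed c \<noteq> \<sigma>\<^sub>V base" if c: "c \<in> \<sigma>\<^sub>A ` A" for c
    proof
      assume h: "head trimmed c = \<sigma>\<^sub>V base"
      from c obtain a where "a \<in> A" "c = \<sigma>\<^sub>A a" by blast
      with h AT have "\<sigma>\<^sub>V (tail trimmed a) = \<sigma>\<^sub>V base" "tail trimmed a \<in> verts G" "base \<in> verts G"
        using T.head_mate base_in X_verts T.tail_in_verts verts_trim by auto
      then show False
        using no_tail[OF \<open>a \<in> A\<close>] node_mate_mate by metis
    qed
    then show ?thesis
      using lift_circulation_avoiding T.circulation_mate[OF A] by blast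
  qed
qed

end

section \<open>The search and its blossoms\<close>

fun mate_colour :: "colour \<Rightarrow> colour" where
  "mate_colour White = White"
| "mate_colour Gray = Antigray"
| "mate_colour Black = Antiblack"
| "mate_colour Antigray = Gray"
| "mate_colour Antiblack = Black"

text \<open>
  The rank \<open>r\<close> of a node is the time at which it became gray or, once it is black, the time
  at which it became black. For a gray node \<open>w\<close>, the descendants of \<open>w\<close> in the forest are
  thus the nodes of larger rank.
\<close>

locale search = skew_symmetric_graph G \<sigma>\<^sub>V \<sigma>\<^sub>A
  for G :: "('a, 'b) pre_digraph" and \<sigma>\<^sub>V :: "'a \<Rightarrow> 'a" and \<sigma>\<^sub>A :: "'b \<Rightarrow> 'b" +
  fixes F :: "'b set" and colr :: "'a \<Rightarrow> colour" and stk :: "('a \<times> 'b set) list" and r :: "'a \<Rightarrow> nat"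
  assumes degree: "degree_property G"
    and loop: "loop_property \<sigma>\<^sub>V G"
    and colr_mate: "v \<in> verts G \<Longrightarrow> colr (\<sigma>\<^sub>V v) = mate_colour (colr v)"
    and gray_stack: "fst ` set stk = {v \<in> verts G. colr v = Gray}"
    and stack_sorted: "sorted_wrt (\<lambda>x y. r y < r x) (map fst stk)"
    and r_inj: "inj_on r {v \<in> verts G. colr v \<in> {Gray, Black}}"
    and F_sub: "F \<subseteq> arcs G"
    and F_colr: "a \<in> F \<Longrightarrow> colr (tail G a) \<in> {Gray, Black} \<and> colr (head G a) \<in> {Gray, Black}"
    and F_inj: "inj_on (head G) F"
    and F_stack: "Suc i < length stk \<Longrightarrow>
      \<exists>g \<in> F. tail G g = fst (stk ! Suc i) \<and> head G g = fst (stk ! i)"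
    and root: "stk \<noteq> [] \<Longrightarrow> out_degree G (fst (last stk)) \<le> 1"
    and F_reach: "\<lbrakk>w \<in> verts G; colr w = Gray; y \<in> verts G; colr y \<in> {Gray, Black}\<rbrakk> \<Longrightarrow>
      (w, y) \<in> (arc_rel G F)\<^sup>* \<longleftrightarrow> r w \<le> r y"
    and black_arc: "\<lbrakk>a \<in> arcs G; colr (tail G a) = Black\<rbrakk> \<Longrightarrow>
      colr (head G a) = Black \<and> r (head G a) < r (tail G a) \<or>
      colr (head G a) = Antigray \<and> r (\<sigma>\<^sub>V (head G a)) < r (tail G a)"
    and scanned_tail: "\<lbrakk>(u, S) \<in> set stk; a \<in> S; a \<in> arcs G\<rbrakk> \<Longrightarrow> tail G a = u"
    and scanned: "\<lbrakk>(u, S) \<in> set stk; a \<in> S; a \<in> arcs G\<rbrakk> \<Longrightarrow>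
      colr (head G a) = Black \<and>
        (\<forall>w \<in> verts G. colr w = Gray \<longrightarrow> r u < r w \<longrightarrow> r (head G a) < r w) \<or>
      colr (head G a) = Antigray \<and> r (\<sigma>\<^sub>V (head G a)) < r u \<or>
      colr (head G a) = Gray \<and> a \<in> F \<and> r u < r (head G a)"
begin

lemma colr_mate_iff [simp]:
  assumes "v \<in> verts G"
  shows "colr (\<sigma>\<^sub>V v) = White \<longleftrightarrow> colr v = White"
    "colr (\<sigma>\<^sub>V v) = Gray \<longleftrightarrow> colr v = Antigray"
    "colr (\<sigma>\<^sub>V v) = Black \<longleftrightarrow> colr v = Antiblack"
    "colr (\<sigma>\<^sub>V v) = Antigray \<longleftrightarrow> colr v = Gray"
    "colr (\<sigma>\<^sub>V v) = Antiblack \<longleftrightarrow> colr v = Black"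
  by (cases "colr v"; simp add: colr_mate[OF assms])+

lemma F_arcs: "a \<in> F \<Longrightarrow> a \<in> arcs G"
  using F_sub by blast

lemma stk_gray: "i < length stk \<Longrightarrow> colr (fst (stk ! i)) = Gray \<and> fst (stk ! i) \<in> verts G"
  using gray_stack by (metis (mono_tags, lifting) imageI mem_Collect_eq nth_mem)

lemma gray_in_stk:
  assumes "w \<in> verts G" "colr w = Gray"
  obtains i where "i < length stk" "w = fst (stk ! i)"
proof -
  have "w \<in> fst ` set stk" using gray_stack assms by blast
  then show thesis using that by (auto simp: in_set_conv_nth)
qed

lemma stk_r_less: "i < j \<Longrightarrow> j < length stk \<Longrightarrow> r (fst (stk ! j)) < r (fst (stk ! i))"
  using stack_sorted by (simp add: sorted_wrt_iff_nth_less)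

text \<open>Ends of forest arcs are gray or black, ends of their mates antigray or antiblack. Hence
  every path of the forest is regular.\<close>

lemma mate_not_F: "a \<in> F \<Longrightarrow> \<sigma>\<^sub>A a \<notin> F"
  using F_colr[of a] F_colr[of "\<sigma>\<^sub>A a"] F_arcs[of a] tail_mate[of a]
  by (metis arc_mate_mate colr_mate_iff(2,3) colour.distinct insertE singletonD tail_in_verts
      head_mate head_in_verts)

text \<open>Built from the locale parameters only; \<open>search_forest_graph\<close> identifies it
  with the forest kept in the state.\<close>

definition forest :: "('a, 'b) pre_digraph" where
  "forest = \<lparr> verts = {v \<in> verts G. colr v \<in> {Gray, Black}}, arcs = F, tail = tail G, head = head G \<rparr>"

lemma forest_simps [simp]:
  "verts forest = {v \<in> verts G. colr v \<in> {Gray, Black}}" "arcs forest = F"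
  "tail forest = tail G" "head forest = head G"
  by (simp_all add: forest_def)

lemma wf_forest: "wf_digraph forest"
proof
  fix e assume "e \<in> arcs forest"
  then show "tail forest e \<in> verts forest" "head forest e \<in> verts forest"
    using F_colr[of e] F_arcs[of e] by auto
qed

lemma forest_cas: "pre_digraph.cas forest = cas"
  and forest_awalk_verts: "pre_digraph.awalk_verts forest = awalk_verts"
  using compatible_cas[of forest G] compatible_awalk_verts[of forest G]
  by (simp_all add: compatible_def)

lemma arcs_ends_forest: "arcs_ends forest = arc_rel G F"
  by (simp add: arcs_ends_conv arc_rel_def)

lemma no_arc_to_mate: "a \<in> arcs G \<Longrightarrow> head G a \<noteq> \<sigma>\<^sub>V (tail G a)"
  using loop by (simp add: loop_property_def)

end

section \<open>Mates of walks, and the blossom found by scanning an arc with antiblack head\<close>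

lemma (in skew_symmetric_graph) cas_mate:
  "cas x q y \<Longrightarrow> set q \<subseteq> arcs G \<Longrightarrow> cas (\<sigma>\<^sub>V y) (rev (map \<sigma>\<^sub>A q)) (\<sigma>\<^sub>V x)"
proof (induction q arbitrary: x)
  case (Cons a q)
  then have IH: "cas (\<sigma>\<^sub>V y) (rev (map \<sigma>\<^sub>A q)) (\<sigma>\<^sub>V (head G a))" by simp
  then have "awlast (\<sigma>\<^sub>V y) (rev (map \<sigma>\<^sub>A q)) = \<sigma>\<^sub>V (head G a)"
    by (rule awlast_if_cas)
  then show ?case
    using IH Cons.prems by (auto simp: tail_mate head_mate)
qed simp

lemma (in skew_symmetric_graph) awalk_verts_mate:
  assumes "cas x q y" "set q \<subseteq> arcs G"
  shows "awalk_verts (\<sigma>\<^sub>V y) (rev (map \<sigma>\<^sub>A q)) = rev (map \<sigma>\<^sub>V (awalk_verts x q))"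
proof (cases "q = []")
  case False
  then have "head G (last q) = y"
    using assms(1) by (metis awalk_verts_conv awlast_if_cas last_snoc)
  then have x_verts: "awalk_verts x q = map (tail G) q @ [y]"
    using False by (simp add: awalk_verts_conv)
  have "awalk_verts (\<sigma>\<^sub>V y) (rev (map \<sigma>\<^sub>A q)) = tail G (\<sigma>\<^sub>A (last q)) # map (head G) (rev (map \<sigma>\<^sub>A q))"
    using False awalk_verts_conv'[OF cas_mate[OF assms]] by (simp add: hd_rev last_map)
  also have "tail G (\<sigma>\<^sub>A (last q)) = \<sigma>\<^sub>V y"
    using False assms(2) \<open>head G (last q) = y\<close> by (auto simp: tail_mate subset_iff)
  also have "map (head G) (rev (map \<sigma>\<^sub>A q)) = rev (map \<sigma>\<^sub>V (map (tail G) q))"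
    using assms(2) by (auto simp: head_mate rev_map[symmetric])
  finally show ?thesis
    by (simp add: x_verts)
qed (use assms in simp)

text \<open>The bud property of \<open>X\<close> is not assumed but derived in \<open>bud_X\<close>,
  so that the locale serves both for a trimming that has been performed and for showing that one can
  be performed.\<close>

locale scan_blossom = search G \<sigma>\<^sub>V \<sigma>\<^sub>A F colr stk r
  for G :: "('a, 'b) pre_digraph" and \<sigma>\<^sub>V :: "'a \<Rightarrow> 'a" and \<sigma>\<^sub>A :: "'b \<Rightarrow> 'b"
    and F :: "'b set" and colr :: "'a \<Rightarrow> colour" and stk :: "('a \<times> 'b set) list" and r :: "'a \<Rightarrow> nat" +
  fixes u :: 'a and S :: "'b set" and cs :: "('a \<times> 'b set) list" and e b :: 'b and p :: "'b list"
    and X :: "'a set"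
  assumes stk_eq: "stk = (u, S) # cs"
    and e_arc: "e \<in> arcs G" and tail_e: "tail G e = u" and head_e: "colr (head G e) = Antiblack"
    and b_F: "b \<in> F" and head_b: "head G b = u"
    and p_forest: "pre_digraph.apath forest u p (\<sigma>\<^sub>V (head G e))"
    and X_eq: "X = set (awalk_verts u p) \<union> \<sigma>\<^sub>V ` set (awalk_verts u p)"
begin

abbreviation P :: "'a set" where "P \<equiv> set (awalk_verts u p)"

lemma u_gray: "u \<in> verts G" "colr u = Gray"
  using stk_gray[of 0] by (auto simp: stk_eq)

lemma gray_le_top: "w \<in> verts G \<Longrightarrow> colr w = Gray \<Longrightarrow> r w \<le> r u"
proof -
  assume "w \<in> verts G" "colr w = Gray"
  then obtain i where "i < length stk" "w = fst (stk ! i)" by (rule gray_in_stk)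
  then show "r w \<le> r u"
    using stk_r_less[of 0 i] by (cases "i = 0") (auto simp: stk_eq)
qed

lemma p_F: "set p \<subseteq> F" and p_cas: "cas u p (\<sigma>\<^sub>V (head G e))" and p_distinct: "distinct (awalk_verts u p)"
  using p_forest
  by (simp_all add: pre_digraph.apath_def pre_digraph.awalk_def forest_cas forest_awalk_verts)

lemma P_forest: "y \<in> P \<Longrightarrow> y \<in> verts G \<and> colr y \<in> {Gray, Black}"
  using wf_digraph.awalk_verts_in_verts[OF wf_forest, of u p] p_F u_gray
  by (auto simp: forest_awalk_verts)

lemma P_reach: "y \<in> P \<Longrightarrow> (u, y) \<in> (arc_rel G F)\<^sup>*"
proof -
  assume y: "y \<in> P"
  have "pre_digraph.awalk forest u p (\<sigma>\<^sub>V (head G e))"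
    using p_forest by (simp add: pre_digraph.apath_def)
  then have "u \<rightarrow>\<^sup>*\<^bsub>forest\<^esub> y"
    using wf_digraph.awalk_verts_reachable_from[OF wf_forest] y by (simp add: forest_awalk_verts)
  then show ?thesis
    by (auto dest: reachable_rtranclI simp: arcs_ends_forest)
qed

lemma P_rank: "y \<in> P \<Longrightarrow> r u \<le> r y"
  using F_reach[of u y] P_reach P_forest u_gray by blast

text \<open>\<open>u\<close> is the top of the stack and has the largest rank among the gray nodes,
  while its descendants have at least its rank.\<close>

lemma P_black: "y \<in> P \<Longrightarrow> y \<noteq> u \<Longrightarrow> colr y = Black"
proof (rule ccontr)
  assume y: "y \<in> P" "y \<noteq> u" "colr y \<noteq> Black"
  then have "y \<in> verts G" "colr y = Gray" using P_forest by auto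
  with y gray_le_top P_rank have "r y = r u" by (meson le_antisym)
  then show False
    using r_inj y \<open>y \<in> verts G\<close> \<open>colr y = Gray\<close> u_gray by (auto dest: inj_onD)
qed

lemma P_rank_less: "y \<in> P \<Longrightarrow> y \<noteq> u \<Longrightarrow> r u < r y"
  using P_rank[of y] P_forest[of y] r_inj u_gray
  by (metis (mono_tags, lifting) inj_onD insert_iff le_neq_implies_less mem_Collect_eq)

lemma u_in_P: "u \<in> P"
  using p_cas by (cases p) auto

lemma end_in_P: "\<sigma>\<^sub>V (head G e) \<in> P"
  using awlast_if_cas[OF p_cas] by (metis awalk_verts_non_Nil last_in_set)

lemma X_cases:
  assumes "x \<in> X"
  obtains (base) "x = u" | (black) "x \<in> P" "x \<noteq> u" "colr x = Black" "r u < r x" "x \<in> verts G"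
    | (mate) "x = \<sigma>\<^sub>V u"
    | (antiblack) "\<sigma>\<^sub>V x \<in> P" "\<sigma>\<^sub>V x \<noteq> u" "colr x = Antiblack" "r u < r (\<sigma>\<^sub>V x)" "x \<in> verts G"
proof -
  consider "x \<in> P" | y where "x = \<sigma>\<^sub>V y" "y \<in> P" using assms X_eq by blast
  then show thesis
  proof cases
    case 1
    then show thesis using base black P_black P_rank_less P_forest by blast
  next
    case 2
    then have "\<sigma>\<^sub>V x = y" "y \<in> verts G" "x \<in> verts G"
      using P_forest node_mate_mate node_mate_in by blast+
    then show thesis
      using 2 mate antiblack P_black[of y] P_rank_less[of y] by (cases "y = u") auto
  qed
qed

lemma X_gray: "x \<in> X \<Longrightarrow> colr x = Gray \<Longrightarrow> x = u"
  by (erule X_cases) (use u_gray in auto)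

lemma X_antigray: "x \<in> X \<Longrightarrow> colr x = Antigray \<Longrightarrow> x = \<sigma>\<^sub>V u"
  by (erule X_cases) (use u_gray in auto)

lemma X_black: "x \<in> X \<Longrightarrow> colr x = Black \<Longrightarrow> x \<in> P \<and> x \<noteq> u \<and> r u < r x"
  by (erule X_cases) (use u_gray in auto)

lemma X_sub: "X \<subseteq> verts G"
  by (auto elim!: X_cases simp: u_gray node_mate_in)

lemma X_self_symmetric: "\<sigma>\<^sub>V ` X = X"
proof -
  have "\<sigma>\<^sub>V ` \<sigma>\<^sub>V ` P = P"
    using P_forest node_mate_mate by (force simp: image_image)
  then show ?thesis unfolding X_eq by (auto simp: image_Un)
qed

text \<open>\<open>e\<close> and the first arc of \<open>p\<close> both leave \<open>u\<close> and
  differ, because \<open>e\<close> leads to an antiblack node and forest arcs do not. By the degree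
  property \<open>u\<close> then has a single entering arc, and it cannot be the root.\<close>

lemma out_degree_u: "2 \<le> out_degree G u"
proof -
  have "p \<noteq> []"
  proof
    assume "p = []"
    then have "\<sigma>\<^sub>V (head G e) = u" using p_cas by simp
    then show False using head_e u_gray e_arc by (metis colr_mate_iff(3) colour.distinct(9) head_in_verts)
  qed
  then obtain g q where g: "p = g # q" by (cases p) auto
  then have "g \<in> F" "tail G g = u" using p_F p_cas by auto
  then have "{e, g} \<subseteq> out_arcs G u" "e \<noteq> g"
    using e_arc tail_e F_arcs F_colr[of g] head_e by auto
  then have "2 = card {e, g}" by simp
  also have "\<dots> \<le> card (out_arcs G u)"
    by (rule card_mono) (use \<open>{e, g} \<subseteq> out_arcs G u\<close> in auto)
  finally show ?thesis by (simp add: out_degree_def)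
qed

lemma stk_not_root: "cs \<noteq> []"
  using root out_degree_u by (auto simp: stk_eq)

lemma in_arcs_u: "in_arcs G u = {b}"
proof -
  have "in_degree G u \<le> 1"
    using degree out_degree_u u_gray by (auto simp: degree_property_def)
  then have "card (in_arcs G u) \<le> 1" by (simp add: in_degree_def)
  moreover have "b \<in> in_arcs G u" using b_F F_arcs head_b by simp
  ultimately show ?thesis
    by (metis card_le_Suc0_iff_eq finite_in_arcs One_nat_def subsetI subset_singletonD emptyE
        equals0D singleton_iff)
qed

lemma tail_b_stk: "tail G b = fst (stk ! Suc 0)" "Suc 0 < length stk"
proof -
  show l: "Suc 0 < length stk" using stk_not_root by (simp add: stk_eq)
  then obtain g where "g \<in> F" "tail G g = fst (stk ! Suc 0)" "head G g = u"
    using F_stack[of 0] by (auto simp: stk_eq)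
  then show "tail G b = fst (stk ! Suc 0)"
    using F_inj b_F head_b by (metis inj_onD)
qed

lemma tail_b_notin: "tail G b \<notin> X"
proof
  assume "tail G b \<in> X"
  moreover have "colr (tail G b) = Gray" "r (tail G b) < r u"
    using tail_b_stk stk_gray[of "Suc 0"] stk_r_less[of 0 "Suc 0"] by (auto simp: stk_eq)
  ultimately show False using X_gray by blast
qed

text \<open>A node of \<open>P\<close> is reached along a prefix of \<open>p\<close>. The mate of a
  node \<open>y\<close> of \<open>P\<close> is reached by \<open>e\<close> followed by the mates of
  the part of \<open>p\<close> after \<open>y\<close>, in reverse order; this is regular because
  \<open>e\<close> is not a forest arc and the other arcs are mates of forest arcs.\<close>

lemma bud_X: "bud \<sigma>\<^sub>V \<sigma>\<^sub>A G X b"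
  unfolding bud_def
proof (intro conjI ballI)
  show "X \<subseteq> verts G" "\<sigma>\<^sub>V ` X = X" by (fact X_sub X_self_symmetric)+
  show "b \<in> entering G X"
    using b_F F_arcs head_b tail_b_notin u_in_P X_eq by (auto simp: entering_def)
  interpret Fo: wf_digraph forest by (rule wf_forest)
  have cas_X: "pre_digraph.cas (G \<restriction> X) = cas" and verts_X: "pre_digraph.awalk_verts (G \<restriction> X) = awalk_verts"
    using compatible_cas[of "G \<restriction> X" G] compatible_awalk_verts[of "G \<restriction> X" G]
    by (simp_all add: compatible_def)
  have PX: "P \<subseteq> X" using X_eq by blast
  have walk: "Fo.awalk u p (\<sigma>\<^sub>V (head G e))"
    using p_forest by (simp add: Fo.apath_def)
  have ends_P: "tail G g \<in> P \<and> head G g \<in> P" if "g \<in> set p" for g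
    using Fo.awalk_verts_arc1[OF that] Fo.awalk_verts_arc2[OF walk that]
    by (simp add: forest_awalk_verts)
  fix x assume "x \<in> X"
  then consider "x \<in> P" | y where "x = \<sigma>\<^sub>V y" "y \<in> P" using X_eq by blast
  then show "\<exists>q. pre_digraph.apath (G \<restriction> X) (head G b) q x \<and> regular \<sigma>\<^sub>A q"
  proof cases
    case 1
    obtain q q' where q: "p = q @ q'" "Fo.apath u q x"
    proof -
      obtain q q' where qq: "p = q @ q'" "Fo.awalk u q x"
        using Fo.awalk_decomp[OF walk, of x] 1 by (auto simp: forest_awalk_verts)
      then have "Fo.apath u q (Fo.awlast u q)"
        using p_forest Fo.apath_append_iff by blast
      then have "Fo.apath u q x"
        using qq(2) Fo.awlast_of_awalk by simp
      then show thesis using that qq by blast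
    qed
    have "pre_digraph.apath (G \<restriction> X) u q x"
      using q ends_P F_arcs p_F u_in_P PX unfolding pre_digraph.apath_def pre_digraph.awalk_def
      by (auto simp: cas_X verts_X forest_cas forest_awalk_verts)
    moreover have "regular \<sigma>\<^sub>A q"
      using q p_F mate_not_F unfolding regular_def by (metis Un_iff set_append subsetD)
    ultimately show ?thesis using head_b by blast
  next
    case 2
    obtain q q' where q: "p = q @ q'" "Fo.apath y q' (\<sigma>\<^sub>V (head G e))"
    proof -
      obtain q q' where qq: "p = q @ q'" "Fo.awalk u q y"
        using Fo.awalk_decomp[OF walk, of y] 2 by (auto simp: forest_awalk_verts)
      then have "Fo.apath (Fo.awlast u q) q' (\<sigma>\<^sub>V (head G e))"
        using p_forest Fo.apath_append_iff by blast
      then have "Fo.apath y q' (\<sigma>\<^sub>V (head G e))"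
        using qq(2) Fo.awlast_of_awalk by simp
      then show thesis using that qq by blast
    qed
    have q'_cas: "cas y q' (\<sigma>\<^sub>V (head G e))" and q'_F: "set q' \<subseteq> F" and q'_dist: "distinct (awalk_verts y q')"
      using q by (auto simp: Fo.apath_def Fo.awalk_def forest_cas forest_awalk_verts)
    have q'_P: "set (awalk_verts y q') \<subseteq> P"
      using set_awalk_verts_cas[OF q'_cas] ends_P q 2 by auto
    have q'_arcs: "set q' \<subseteq> arcs G" using q'_F F_arcs by blast
    have he: "\<sigma>\<^sub>V (\<sigma>\<^sub>V (head G e)) = head G e" using e_arc by (simp add: node_mate_mate)
    let ?t = "rev (map \<sigma>\<^sub>A q')"
    have t_cas: "cas (head G e) ?t x"
      using cas_mate[OF q'_cas q'_arcs] he 2 by simp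
    have t_verts: "awalk_verts (head G e) ?t = rev (map \<sigma>\<^sub>V (awalk_verts y q'))"
      using awalk_verts_mate[OF q'_cas q'_arcs] he by simp
    have u_notin: "u \<notin> \<sigma>\<^sub>V ` P"
      using P_forest colr_mate_iff u_gray by fastforce
    have "distinct (map \<sigma>\<^sub>V (awalk_verts y q'))"
      using q'_dist q'_P P_forest node_mate_mate unfolding distinct_map
      by (metis (no_types, opaque_lifting) inj_on_inverseI subsetD)
    then have "distinct (awalk_verts u (e # ?t))"
      using t_verts u_notin q'_P tail_e by auto
    moreover have "set (e # ?t) \<subseteq> arcs (G \<restriction> X)"
    proof -
      have "g \<in> arcs (G \<restriction> X)" if "g \<in> set ?t" for g
      proof -
        from that obtain f where "f \<in> set q'" "g = \<sigma>\<^sub>A f" by auto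
        then show ?thesis
          using q ends_P[of f] q'_arcs by (auto simp: tail_mate head_mate arc_mate_in X_eq)
      qed
      moreover have "e \<in> arcs (G \<restriction> X)"
      proof -
        have "\<sigma>\<^sub>V (\<sigma>\<^sub>V (head G e)) \<in> X" using end_in_P X_eq by blast
        then show ?thesis using e_arc tail_e u_in_P he by (simp add: X_eq)
      qed
      ultimately show ?thesis by auto
    qed
    ultimately have "pre_digraph.apath (G \<restriction> X) u (e # ?t) x"
      using t_cas tail_e u_in_P PX
      unfolding pre_digraph.apath_def pre_digraph.awalk_def cas_X verts_X by auto
    moreover have "regular \<sigma>\<^sub>A (e # ?t)"
    proof -
      have t_mate: "g \<in> arcs G \<and> \<sigma>\<^sub>A g \<in> F" if "g \<in> set ?t" for g
      proof -
        from that obtain f where "f \<in> set q'" "g = \<sigma>\<^sub>A f" by auto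
        moreover then have "f \<in> F" "f \<in> arcs G" using q'_F q'_arcs by auto
        ultimately show ?thesis using arc_mate_mate arc_mate_in by simp
      qed
      have "e \<notin> F" using F_colr[of e] head_e by auto
      moreover have "\<sigma>\<^sub>A e \<notin> set ?t"
        using \<open>e \<notin> F\<close> t_mate[of "\<sigma>\<^sub>A e"] e_arc arc_mate_mate by auto
      moreover have "\<sigma>\<^sub>A g \<noteq> e" if "g \<in> set ?t" for g
        using t_mate that \<open>e \<notin> F\<close> by auto
      moreover have "\<sigma>\<^sub>A g \<notin> set ?t" if "g \<in> set ?t" for g
      proof
        assume "\<sigma>\<^sub>A g \<in> set ?t"
        then show False
          using t_mate[of g] t_mate[of "\<sigma>\<^sub>A g"] that mate_not_F[of "\<sigma>\<^sub>A g"] by blast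
      qed
      ultimately show ?thesis
        using arc_mate_neq[OF e_arc] unfolding regular_def by auto
    qed
    ultimately show ?thesis using head_b by blast
  qed
qed

end

sublocale scan_blossom \<subseteq> bud_trimming G \<sigma>\<^sub>V \<sigma>\<^sub>A X b
  by unfold_locales (rule bud_X)

section \<open>Trimming a blossom\<close>

lemma arc_rel_rtrancl_mono: "(x, y) \<in> (arc_rel G A)\<^sup>* \<Longrightarrow> A \<subseteq> B \<Longrightarrow> (x, y) \<in> (arc_rel G B)\<^sup>*"
  using rtrancl_mono[OF arc_rel_mono] by blast

lemma arc_rel_trancl_mono: "(x, y) \<in> (arc_rel G A)\<^sup>+ \<Longrightarrow> A \<subseteq> B \<Longrightarrow> (x, y) \<in> (arc_rel G B)\<^sup>+"
  using trancl_mono[OF _ arc_rel_mono] by blast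

section \<open>The stack as a path of the forest, and its mate\<close>

context search
begin

text \<open>Index 0 is the innermost call and the last index the root. Stack arcs therefore run from
  larger to smaller indices, their mates from smaller to larger.\<close>

definition node :: "nat \<Rightarrow> 'a" where
  "node j = fst (stk ! j)"

definition link :: "nat \<Rightarrow> 'b" where
  "link j = (SOME g. g \<in> F \<and> tail G g = node j \<and> head G g = node (j - 1))"

lemma link:
  assumes "0 < j" "j < length stk"
  shows "link j \<in> F" "tail G (link j) = node j" "head G (link j) = node (j - 1)"
proof -
  have "\<exists>g. g \<in> F \<and> tail G g = node j \<and> head G g = node (j - 1)"
    using F_stack[of "j - 1"] assms by (auto simp: node_def)
  from someI_ex[OF this] show "link j \<in> F" "tail G (link j) = node j" "head G (link j) = node (j - 1)"
    by (simp_all add: link_def)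
qed

lemma node_gray: "j < length stk \<Longrightarrow> colr (node j) = Gray" "j < length stk \<Longrightarrow> node j \<in> verts G"
  using stk_gray by (simp_all add: node_def)

lemma node_rank: "i < j \<Longrightarrow> j < length stk \<Longrightarrow> r (node j) < r (node i)"
  using stk_r_less by (simp add: node_def)

lemma node_inj: "i < length stk \<Longrightarrow> j < length stk \<Longrightarrow> node i = node j \<longleftrightarrow> i = j"
  using node_rank by (metis less_irrefl nat_neq_iff)

lemma mate_node: "j < length stk \<Longrightarrow> \<sigma>\<^sub>V (\<sigma>\<^sub>V (node j)) = node j"
  "j < length stk \<Longrightarrow> colr (\<sigma>\<^sub>V (node j)) = Antigray" "j < length stk \<Longrightarrow> \<sigma>\<^sub>V (node j) \<in> verts G"
  using node_gray by (simp_all add: node_mate_mate node_mate_in)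

lemma mate_node_inj:
  "i < length stk \<Longrightarrow> j < length stk \<Longrightarrow> \<sigma>\<^sub>V (node i) = \<sigma>\<^sub>V (node j) \<longleftrightarrow> i = j"
  using mate_node node_inj by metis

lemma node_neq_mate: "i < length stk \<Longrightarrow> j < length stk \<Longrightarrow> node i \<noteq> \<sigma>\<^sub>V (node j)"
  using node_gray(1)[of i] mate_node(2)[of j] by auto

lemma antigray_node:
  assumes "x \<in> verts G" "colr x = Antigray"
  obtains j where "j < length stk" "x = \<sigma>\<^sub>V (node j)"
proof -
  have "\<sigma>\<^sub>V x \<in> verts G" "colr (\<sigma>\<^sub>V x) = Gray"
    using assms by (simp_all add: node_mate_in)
  then obtain j where "j < length stk" "\<sigma>\<^sub>V x = node j"
    using gray_in_stk node_def by metis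
  then show thesis using that assms node_mate_mate by metis
qed

lemma mate_link:
  assumes "0 < j" "j < length stk"
  shows "\<sigma>\<^sub>A (link j) \<in> arcs G" "tail G (\<sigma>\<^sub>A (link j)) = \<sigma>\<^sub>V (node (j - 1))"
    "head G (\<sigma>\<^sub>A (link j)) = \<sigma>\<^sub>V (node j)"
  using link[OF assms] F_arcs by (simp_all add: arc_mate_in tail_mate head_mate)

text \<open>If two arcs leave a gray node, the degree property leaves room for one entering arc
  only, the stack arc. So a circuit that reaches the mate of this node has to continue along the
  mate of the stack arc.\<close>

lemma in_arcs_node:
  assumes "Suc j < length stk" "\<not> out_degree G (node j) \<le> 1"
  shows "in_arcs G (node j) = {link (Suc j)}" "out_arcs G (\<sigma>\<^sub>V (node j)) = {\<sigma>\<^sub>A (link (Suc j))}"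
proof -
  have "card (in_arcs G (node j)) \<le> Suc 0"
    using degree assms node_gray(2)[of j] by (auto simp: degree_property_def in_degree_def)
  moreover have "link (Suc j) \<in> in_arcs G (node j)"
    using link[of "Suc j"] assms F_arcs by simp
  ultimately show *: "in_arcs G (node j) = {link (Suc j)}"
    by (metis card_le_Suc0_iff_eq finite_in_arcs is_singletonI' is_singleton_the_elem singletonD empty_iff)
  show "out_arcs G (\<sigma>\<^sub>V (node j)) = {\<sigma>\<^sub>A (link (Suc j))}"
    using out_arcs_mate[of "node j"] node_gray(2)[of j] assms by (simp add: *)
qed

lemma root_node: "stk \<noteq> [] \<Longrightarrow> out_degree G (node (length stk - 1)) \<le> 1"
  using root by (simp add: node_def last_conv_nth)

end

section \<open>How circulations cross the blossom\<close>

context scan_blossom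
begin

lemma node_0: "node 0 = u" and length_stk: "0 < length stk"
  using node_def[of 0] by (simp_all add: stk_eq)

lemma link_1: "link (Suc 0) = b"
  using link[of "Suc 0"] tail_b_stk(2) F_inj b_F head_b node_0 by (auto dest: inj_onD)

lemma mate_u: "\<sigma>\<^sub>V (\<sigma>\<^sub>V u) = u" "\<sigma>\<^sub>V u \<in> verts G" "colr (\<sigma>\<^sub>V u) = Antigray"
  using u_gray by (simp_all add: node_mate_mate node_mate_in)

lemma u_in_X: "u \<in> X" "\<sigma>\<^sub>V u \<in> X"
  using u_in_P X_eq by auto

lemma out_arcs_mate_u: "out_arcs G (\<sigma>\<^sub>V u) = {\<sigma>\<^sub>A b}"
  using out_arcs_mate[OF u_gray(1)] in_arcs_u by simp

lemma leaving_mate_u: "c \<in> arcs G \<Longrightarrow> tail G c = \<sigma>\<^sub>V u \<Longrightarrow> c = \<sigma>\<^sub>A b"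
  using out_arcs_mate_u by (metis in_out_arcs_conv singletonD)

lemma entering_u: "c \<in> arcs G \<Longrightarrow> head G c = u \<Longrightarrow> c = b"
  using in_arcs_u by (metis in_in_arcs_conv singletonD)

lemma mate_b_leaving: "tail G (\<sigma>\<^sub>A b) = \<sigma>\<^sub>V u" "head G (\<sigma>\<^sub>A b) \<notin> X" "\<sigma>\<^sub>A b \<in> arcs G"
  using mate_b head_b by simp_all

lemma node_notin_X: "0 < j \<Longrightarrow> j < length stk \<Longrightarrow> node j \<notin> X"
  "0 < j \<Longrightarrow> j < length stk \<Longrightarrow> \<sigma>\<^sub>V (node j) \<notin> X"
  using X_gray[of "node j"] node_gray[of j] node_inj[of j 0] length_stk node_0 X_mate_iff[of "node j"]
  by auto

text \<open>Trimming moves these arcs to the base \<open>u\<close> even if the circulation did not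
  enter \<open>X\<close> through \<open>b\<close>; they are the obstacle to restricting it to the
  trimmed graph. Their mates are entrances at antiblack nodes.\<close>

definition black_exits :: "'b set \<Rightarrow> 'b set" where
  "black_exits A = {f \<in> A. tail G f \<in> X \<and> colr (tail G f) = Black \<and> head G f \<notin> X}"

text \<open>The rank falls along black nodes, and no black exit occurs below the smallest rank of
  such exits, so the walk is caught in \<open>X\<close> until it meets an antigray node. That can
  only be the mate of \<open>u\<close>, whose sole exit is the mate of \<open>b\<close>.\<close>

lemma black_run_in_X:
  assumes sub: "A \<subseteq> arcs G" and succ: "\<And>a. a \<in> A \<Longrightarrow> \<exists>c \<in> A. tail G c = head G a"
  shows "\<lbrakk>a \<in> A; tail G a \<in> X; colr (tail G a) = Black; head G a \<in> X;
      \<forall>f \<in> black_exits A. r (tail G a) \<le> r (tail G f)\<rbrakk> \<Longrightarrow> \<sigma>\<^sub>A b \<in> A"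
proof (induction "r (tail G a)" arbitrary: a rule: less_induct)
  case less
  obtain c where c: "c \<in> A" "tail G c = head G a" using succ less.prems by blast
  from black_arc[of a] less.prems sub consider
    "colr (head G a) = Black" "r (head G a) < r (tail G a)" | "colr (head G a) = Antigray"
    by blast
  then show ?case
  proof cases
    case 1
    have "head G c \<in> X"
    proof (rule ccontr)
      assume "head G c \<notin> X"
      then have "c \<in> black_exits A" using c less.prems 1 by (simp add: black_exits_def)
      then show False using less.prems(5) 1 c by fastforce
    qed
    moreover have "\<forall>f \<in> black_exits A. r (tail G c) \<le> r (tail G f)"
      using less.prems(5) 1 c by fastforce
    ultimately show ?thesis using less.hyps[of c] c less.prems 1 by metis
  next
    case 2
    then have "head G a = \<sigma>\<^sub>V u" using X_antigray less.prems by blast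
    then show ?thesis using c sub leaving_mate_u by auto
  qed
qed

text \<open>A walk confined to \<open>X\<close> would end at the mate of \<open>u\<close>, whose
  only exit leaves \<open>X\<close>: among black nodes ranks fall, among antiblack nodes the ranks
  of the mates rise, and \<open>u\<close> cannot be entered from inside \<open>X\<close>. This
  ensures that part of a circulation survives the removal of the arcs inside
  \<open>X\<close>.\<close>

lemma leaves_X:
  assumes sub: "A \<subseteq> arcs G" and succ: "\<And>a. a \<in> A \<Longrightarrow> \<exists>c \<in> A. tail G c = head G a"
    and a: "a \<in> A" "tail G a \<in> X"
  shows "\<exists>c \<in> A. tail G c \<in> X \<and> head G c \<notin> X"
proof -
  let ?L = "\<exists>c \<in> A. tail G c \<in> X \<and> head G c \<notin> X"
  have black: ?L if "d \<in> A" "tail G d \<in> X" "colr (tail G d) = Black" for d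
  proof (cases "head G d \<in> X \<and> black_exits A = {}")
    case True
    then have "\<sigma>\<^sub>A b \<in> A" using black_run_in_X[OF sub succ] that by auto
    then show ?thesis
      using mate_b_leaving u_in_X by (intro bexI[of _ "\<sigma>\<^sub>A b"] conjI) simp_all
  qed (use that in \<open>auto simp: black_exits_def\<close>)
  have mate: ?L if "d \<in> A" "tail G d = \<sigma>\<^sub>V u" for d
    using that leaving_mate_u[of d] sub mate_b_leaving u_in_X
    by (intro bexI[of _ d] conjI) (simp_all add: subset_iff)
  obtain M where M: "\<And>v. v \<in> verts G \<Longrightarrow> r v \<le> M"
    using finite_verts by (metis Max_ge finite_imageI imageI)
  have anti: ?L if "d \<in> A" "tail G d \<in> X" "colr (tail G d) = Antiblack" for d
    using that
  \<comment> \<open>The mate of an arc between antiblack nodes runs between black nodes, so the rank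
    of the mate of the tail grows along the walk; subtracting it from the bound \<open>M\<close>
    gives a decreasing measure.\<close>
  proof (induction d rule: measure_induct_rule[of "\<lambda>d. M - r (\<sigma>\<^sub>V (tail G d))"])
    case (less d)
    then have dG: "d \<in> arcs G" using sub by blast
    obtain c where c: "c \<in> A" "tail G c = head G d" using succ less.prems by blast
    show ?case
    proof (cases "head G d \<in> X")
      case True
      then show ?thesis
      proof (cases rule: X_cases)
        case base
        then show ?thesis using entering_u dG tail_b_notin less.prems by blast
      next
        case black
        then show ?thesis using \<open>\<And>d. \<lbrakk>d \<in> A; tail G d \<in> X; colr (tail G d) = Black\<rbrakk> \<Longrightarrow> ?L\<close> c True by metis
      next
        case mate
        then show ?thesis using \<open>\<And>d. \<lbrakk>d \<in> A; tail G d = \<sigma>\<^sub>V u\<rbrakk> \<Longrightarrow> ?L\<close> c by metis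
      next
        case antiblack
        have "colr (tail G (\<sigma>\<^sub>A d)) = Black" "colr (head G (\<sigma>\<^sub>A d)) = Black"
          using antiblack less.prems dG by (simp_all add: tail_mate head_mate)
        then have "r (\<sigma>\<^sub>V (tail G d)) < r (\<sigma>\<^sub>V (head G d))"
          using black_arc[of "\<sigma>\<^sub>A d"] dG by (simp add: tail_mate head_mate arc_mate_in)
        moreover have "r (\<sigma>\<^sub>V (head G d)) \<le> M"
          using M dG node_mate_in by simp
        ultimately have "M - r (\<sigma>\<^sub>V (tail G c)) < M - r (\<sigma>\<^sub>V (tail G d))"
          using c by simp
        then show ?thesis using less.IH[of c] c antiblack True by metis
      qed
    qed (use less.prems in auto)
  qed
  show ?thesis
  proof (cases "head G a \<in> X")
    case True
    obtain c where c: "c \<in> A" "tail G c = head G a" using succ a by blast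
    have "head G a \<noteq> u"
      using entering_u[of a] a sub tail_b_notin by blast
    then have *: "head G a = \<sigma>\<^sub>V u \<or> colr (head G a) = Black \<or> colr (head G a) = Antiblack"
      using True by (auto elim: X_cases)
    from a(2) show ?thesis
      by (cases rule: X_cases) (use * True c a black mate anti in metis)+
  qed (use a in auto)
qed

text \<open>Dropping the arcs inside \<open>X\<close> leaves a successor-closed set. After
  \<open>b\<close> the walk continues from the base by some arc leaving \<open>X\<close>, which is
  not the mate of \<open>b\<close> by mate-freeness. Every other entrance is moved to the mate of
  the base, where the mate of \<open>b\<close> follows: in \<open>G\<close> such an entrance is at a
  black node or at the mate of \<open>u\<close>, and the circulation is then led to this
  arc.\<close>

lemma circulation_trimmed_direct:
  assumes A: "circulation \<sigma>\<^sub>A G A" and no_exit: "black_exits A = {}"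
    and no_entry: "\<And>a. \<lbrakk>a \<in> A; tail G a \<notin> X; head G a \<in> X\<rbrakk> \<Longrightarrow> colr (head G a) \<noteq> Antiblack"
  shows "\<not> weakly_acyclic \<sigma>\<^sub>A trimmed"
proof -
  interpret T: skew_symmetric_graph trimmed \<sigma>\<^sub>V \<sigma>\<^sub>A by (rule skew_symmetric_trimmed)
  from A have sub: "A \<subseteq> arcs G" and ne: "A \<noteq> {}" and free: "mate_free \<sigma>\<^sub>A A"
    and succ: "\<And>a. a \<in> A \<Longrightarrow> \<exists>c \<in> A. tail G c = head G a"
    by (auto simp: circulation_def)
  define A0 where "A0 = {a \<in> A. \<not> (tail G a \<in> X \<and> head G a \<in> X)}"
  have subT: "A0 \<subseteq> arcs trimmed" using sub by (auto simp: A0_def arcs_trim)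
  have "A0 \<noteq> {}"
    using ne leaves_X[OF sub succ] by (auto simp: A0_def)
  moreover have "mate_free \<sigma>\<^sub>A A0"
    using mate_free_subset[OF free] by (simp add: A0_def)
  moreover have "\<exists>c \<in> A0. tail trimmed c = head trimmed a" if a: "a \<in> A0" for a
  proof -
    from a have aA: "a \<in> A" by (simp add: A0_def)
    obtain c where c: "c \<in> A" "tail G c = head G a" using succ aA by blast
    show ?thesis
    proof (cases "head G a \<in> X")
      case False
      then have "c \<in> A0" using c by (simp add: A0_def)
      then show ?thesis
        using False c a subT by (intro bexI[of _ c]) (auto simp: tail_trim head_trim subset_iff)
    next
      case True
      then have ta: "tail G a \<notin> X" using a by (simp add: A0_def)
      show ?thesis
      proof (cases "a = b")
        case b: True
        obtain d where d: "d \<in> A" "tail G d \<in> X" "head G d \<notin> X"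
          using leaves_X[OF sub succ c(1)] c True by auto
        then have "d \<in> A0" by (simp add: A0_def)
        moreover have "d \<noteq> \<sigma>\<^sub>A b" using free aA b d by (auto simp: mate_free_def)
        ultimately show ?thesis
          using d b subT a by (intro bexI[of _ d]) (auto simp: tail_trim head_trim subset_iff)
      next
        case nb: False
        have "\<sigma>\<^sub>A b \<in> A"
          using True
        proof (cases rule: X_cases)
          case base
          then show ?thesis using entering_u[of a] nb aA sub by blast
        next
          case black
          have "head G c \<in> X"
            using no_exit c black True by (auto simp: black_exits_def)
          then show ?thesis
            using black_run_in_X[OF sub succ, of c] c black True no_exit by auto
        next
          case mate
          then show ?thesis using c leaving_mate_u[of c] sub by auto
        next
          case antiblack
          then show ?thesis using no_entry[OF aA ta True] by blast
        qed
        then have "\<sigma>\<^sub>A b \<in> A0" using mate_b by (simp add: A0_def)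
        then show ?thesis
          using True nb a subT mate_b_trimmed by (intro bexI[of _ "\<sigma>\<^sub>A b"]) (auto simp: head_trim subset_iff)
      qed
    qed
  qed
  ultimately show ?thesis
    using T.successor_closed_imp_not_weakly_acyclic[OF subT] by blast
qed

lemma link_trimmed:
  assumes "0 < j" "j < length stk"
  shows "link j \<in> arcs trimmed" "tail trimmed (link j) = node j" "head trimmed (link j) = node (j - 1)"
proof -
  note l = link[OF assms]
  show m: "link j \<in> arcs trimmed"
    using l F_arcs node_notin_X[OF assms] by (simp add: arcs_trim)
  show "tail trimmed (link j) = node j"
    using l m node_notin_X[OF assms] by (simp add: tail_trim)
  show "head trimmed (link j) = node (j - 1)"
  proof (cases "j = 1")
    case True
    then show ?thesis using link_1 b_trimmed(3) head_b node_0 by simp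
  next
    case False
    then have "node (j - 1) \<notin> X" using assms node_notin_X[of "j - 1"] by simp
    then show ?thesis using l m by (simp add: head_trim)
  qed
qed

lemma mate_link_trimmed:
  assumes "0 < j" "j < length stk"
  shows "\<sigma>\<^sub>A (link j) \<in> arcs trimmed" "tail trimmed (\<sigma>\<^sub>A (link j)) = \<sigma>\<^sub>V (node (j - 1))"
    "head trimmed (\<sigma>\<^sub>A (link j)) = \<sigma>\<^sub>V (node j)"
proof -
  interpret T: skew_symmetric_graph trimmed \<sigma>\<^sub>V \<sigma>\<^sub>A by (rule skew_symmetric_trimmed)
  show "\<sigma>\<^sub>A (link j) \<in> arcs trimmed" "tail trimmed (\<sigma>\<^sub>A (link j)) = \<sigma>\<^sub>V (node (j - 1))"
    "head trimmed (\<sigma>\<^sub>A (link j)) = \<sigma>\<^sub>V (node j)"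
    using link_trimmed[OF assms] by (simp_all add: T.arc_mate_in T.tail_mate T.head_mate)
qed

text \<open>The arcs used are named explicitly, here and for the mate path, since the regularity of
  a glued circuit is checked on the union of its pieces.\<close>

lemma stack_path_trimmed:
  "i < length stk \<Longrightarrow> (node i, u) \<in> (arc_rel trimmed (link ` {1..i}))\<^sup>*"
proof (induction i)
  case (Suc i)
  then have "(node i, u) \<in> (arc_rel trimmed (link ` {1..Suc i}))\<^sup>*"
    by (intro arc_rel_rtrancl_mono[OF Suc.IH]) auto
  moreover have "(node (Suc i), node i) \<in> arc_rel trimmed (link ` {1..Suc i})"
    using link_trimmed[of "Suc i"] Suc.prems by (intro arc_relI'[of "link (Suc i)"]) auto
  ultimately show ?case by (rule converse_rtrancl_into_rtrancl[rotated])
qed (simp add: node_0)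

lemma mate_stack_path_trimmed:
  "i \<le> k \<Longrightarrow> k < length stk \<Longrightarrow>
    (\<sigma>\<^sub>V (node i), \<sigma>\<^sub>V (node k)) \<in> (arc_rel trimmed ((\<lambda>j. \<sigma>\<^sub>A (link j)) ` {i<..k}))\<^sup>*"
proof (induction k rule: dec_induct)
  case (step k)
  let ?m = "\<lambda>j. \<sigma>\<^sub>A (link j)"
  have "(\<sigma>\<^sub>V (node i), \<sigma>\<^sub>V (node k)) \<in> (arc_rel trimmed (?m ` {i<..Suc k}))\<^sup>*"
    using step.prems by (intro arc_rel_rtrancl_mono[OF step.IH]) auto
  moreover have "(\<sigma>\<^sub>V (node k), \<sigma>\<^sub>V (node (Suc k))) \<in> arc_rel trimmed (?m ` {i<..Suc k})"
    using mate_link_trimmed[of "Suc k"] step by (intro arc_relI'[of "?m (Suc k)"]) auto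
  ultimately show ?case by (rule rtrancl_into_rtrancl)
qed simp

end

section \<open>Circulations that leave the blossom at a black node\<close>

context scan_blossom
begin

text \<open>From a rank not above that of the lowest black exit, the circulation runs through black
  nodes of falling rank to an antigray node. If it enters \<open>X\<close> at a black node on the
  way, \<open>black_run_in_X\<close> leads it to the mate of \<open>b\<close>, while in the trimmed
  graph the entering arc already ends at the mate of \<open>u\<close>; hence for
  \<open>m = 0\<close> only membership of the mate of \<open>b\<close> is asserted.\<close>

lemma black_run_trimmed:
  assumes sub: "A \<subseteq> arcs G" and succ: "\<And>a. a \<in> A \<Longrightarrow> \<exists>c \<in> A. tail G c = head G a"
    and min: "\<And>f'. f' \<in> black_exits A \<Longrightarrow> r (tail G f) \<le> r (tail G f')"
    and B: "B = {a \<in> A. colr (tail G a) = Black \<and> \<not> (tail G a \<in> X \<and> head G a \<in> X)}"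
  shows "\<lbrakk>a \<in> B; r (tail G a) \<le> r (tail G f)\<rbrakk> \<Longrightarrow>
    \<exists>m < length stk. (tail trimmed a, \<sigma>\<^sub>V (node m)) \<in> (arc_rel trimmed B)\<^sup>+ \<and>
      (if m = 0 then \<sigma>\<^sub>A b \<in> A else \<exists>c \<in> A. colr (tail G c) = Black \<and> head G c = \<sigma>\<^sub>V (node m))"
proof (induction "r (tail G a)" arbitrary: a rule: less_induct)
  case less
  then have aA: "a \<in> A" and aG: "a \<in> arcs G" and black: "colr (tail G a) = Black"
    and not_in: "\<not> (tail G a \<in> X \<and> head G a \<in> X)"
    using B sub by auto
  have aT: "a \<in> arcs trimmed" using aG not_in by (simp add: arcs_trim)
  have step: "(tail trimmed a, head trimmed a) \<in> (arc_rel trimmed B)\<^sup>+"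
    using less.prems by (intro r_into_trancl arc_relI)
  have "a \<noteq> b" using black tail_b_stk stk_gray by auto
  obtain c where c: "c \<in> A" "tail G c = head G a" using succ aA by blast
  from black_arc[OF aG black] consider
    (black) "colr (head G a) = Black" "r (head G a) < r (tail G a)" | (anti) "colr (head G a) = Antigray"
    by blast
  then show ?case
  proof cases
    case anti
    then obtain m where m: "m < length stk" "head G a = \<sigma>\<^sub>V (node m)"
      using antigray_node aG by (metis head_in_verts)
    have "head trimmed a = \<sigma>\<^sub>V (node m)"
      using m aT \<open>a \<noteq> b\<close> node_0 head_b node_notin_X[of m] by (cases "m = 0") (auto simp: head_trim)
    moreover have "\<sigma>\<^sub>A b \<in> A" if "m = 0"
      using that m c node_0 leaving_mate_u[of c] sub by auto
    ultimately show ?thesis using step m aA black by (intro exI[of _ m]) auto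
  next
    case h: black
    show ?thesis
    proof (cases "head G a \<in> X")
      case True
      then have "head trimmed a = \<sigma>\<^sub>V (node 0)"
        using aT \<open>a \<noteq> b\<close> node_0 head_b by (auto simp: head_trim)
      moreover have "head G c \<in> X"
      proof (rule ccontr)
        assume "head G c \<notin> X"
        then have "c \<in> black_exits A" using c True h by (simp add: black_exits_def)
        then show False using min[of c] c h less.prems by simp
      qed
      then have "\<sigma>\<^sub>A b \<in> A"
        using black_run_in_X[OF sub succ, of c] c True h min less.prems by fastforce
      ultimately show ?thesis using step length_stk by (intro exI[of _ 0]) auto
    next
      case False
      then have "c \<in> B" using c h B by simp
      moreover have "tail trimmed c = head trimmed a"
        using False c aT \<open>c \<in> B\<close> B sub by (simp add: tail_trim head_trim arcs_trim subset_iff)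
      ultimately obtain m where m: "m < length stk"
        "(head trimmed a, \<sigma>\<^sub>V (node m)) \<in> (arc_rel trimmed B)\<^sup>+"
        "if m = 0 then \<sigma>\<^sub>A b \<in> A else \<exists>c \<in> A. colr (tail G c) = Black \<and> head G c = \<sigma>\<^sub>V (node m)"
        using less.hyps[of c] c h less.prems by auto
      then show ?thesis using trancl_trans[OF step m(2)] by (intro exI[of _ m] conjI)
    qed
  qed
qed

text \<open>
  Let the circulation leave the blossom at a black node. Following it through black nodes one
  arrives at the mate of a gray node, then runs along mates of stack arcs up to a gray node
  \<open>node q\<close> of out-degree one. Where the circulation next meets the stack or its mate, a regular
  circuit is closed by stack arcs or by mates of stack arcs.
\<close>

lemma circulation_trimmed_exit:
  assumes A: "circulation \<sigma>\<^sub>A G A" and exit: "black_exits A \<noteq> {}"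
  shows "\<not> weakly_acyclic \<sigma>\<^sub>A trimmed"
proof (rule ccontr)
  assume wa: "\<not> \<not> weakly_acyclic \<sigma>\<^sub>A trimmed"
  interpret T: skew_symmetric_graph trimmed \<sigma>\<^sub>V \<sigma>\<^sub>A by (rule skew_symmetric_trimmed)
  let ?n = "length stk"
  let ?m = "\<lambda>j. \<sigma>\<^sub>A (link j)"
  from A have sub: "A \<subseteq> arcs G" and free: "mate_free \<sigma>\<^sub>A A"
    and succ: "\<And>a. a \<in> A \<Longrightarrow> \<exists>c \<in> A. tail G c = head G a"
    by (auto simp: circulation_def)
  obtain f where f: "f \<in> black_exits A" and min: "\<And>f'. f' \<in> black_exits A \<Longrightarrow> r (tail G f) \<le> r (tail G f')"
  proof -
    obtain f0 where "f0 \<in> black_exits A" using exit by blast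
    then show thesis
      using that
        arg_min_natI[of "\<lambda>f. f \<in> black_exits A" f0 "\<lambda>f. r (tail G f)"]
        arg_min_nat_le[of "\<lambda>f. f \<in> black_exits A" _ "\<lambda>f. r (tail G f)"] by blast
  qed
  define B where "B = {a \<in> A. colr (tail G a) = Black \<and> \<not> (tail G a \<in> X \<and> head G a \<in> X)}"
  have fB: "f \<in> B" and fX: "tail G f \<in> X" "f \<in> arcs trimmed" "f \<noteq> \<sigma>\<^sub>A b"
    using f sub mate_b_leaving(1) mate_u(3) by (auto simp: B_def black_exits_def arcs_trim)
  then have "tail trimmed f = u" using head_b by (simp add: tail_trim)
  then obtain m where m: "m < ?n" and black_run: "(u, \<sigma>\<^sub>V (node m)) \<in> (arc_rel trimmed B)\<^sup>+"
    and m_cases: "if m = 0 then \<sigma>\<^sub>A b \<in> A else \<exists>c \<in> A. colr (tail G c) = Black \<and> head G c = \<sigma>\<^sub>V (node m)"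
    using black_run_trimmed[OF sub succ min B_def fB] by auto
  \<comment> \<open>For \<open>m > 0\<close> the arc on which the black run arrives has a mate that
    leaves \<open>node m\<close> towards an antiblack node, so it differs from the stack arc
    \<open>link m\<close>; for \<open>m = 0\<close> the node is \<open>u\<close>.\<close>
  have out_m: "\<not> out_degree G (node m) \<le> 1"
  proof (cases "m = 0")
    case False
    then obtain c where c: "c \<in> A" "colr (tail G c) = Black" "head G c = \<sigma>\<^sub>V (node m)"
      using m_cases by auto
    then have cG: "c \<in> arcs G" using sub by blast
    have l: "link m \<in> F" "tail G (link m) = node m" "colr (head G (link m)) = Gray"
      using link[of m] False m node_gray(1)[of "m - 1"] by auto
    have mc: "tail G (\<sigma>\<^sub>A c) = node m" "colr (head G (\<sigma>\<^sub>A c)) = Antiblack"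
      using cG c m mate_node(1) by (simp_all add: tail_mate head_mate)
    have "link m \<noteq> \<sigma>\<^sub>A c" using l mc by auto
    then have "2 = card {link m, \<sigma>\<^sub>A c}" by simp
    also have "\<dots> \<le> card (out_arcs G (node m))"
      using l mc F_arcs arc_mate_in[OF cG] by (intro card_mono) auto
    finally show ?thesis by (simp add: out_degree_def)
  qed (use out_degree_u node_0 in simp)
  have root_n: "out_degree G (node (?n - 1)) \<le> 1"
    using root_node stk_eq by simp
  \<comment> \<open>From \<open>m\<close> up to just before \<open>q\<close> every stack node has
    two leaving arcs, so its mate has a single exit and the circulation is forced along the mates of
    the links. Such a \<open>q\<close> exists because the root has out-degree at most one.\<close>
  define q where "q = (LEAST q. m \<le> q \<and> out_degree G (node q) \<le> 1)"
  have n_1: "m \<le> ?n - 1 \<and> out_degree G (node (?n - 1)) \<le> 1" using m root_n by linarith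
  have "m \<le> q \<and> out_degree G (node q) \<le> 1" and q_le: "q \<le> ?n - 1"
    unfolding q_def using n_1 by (rule LeastI, rule Least_le)
  then have q: "m \<le> q" "out_degree G (node q) \<le> 1" by blast+
  have q_min: "\<not> out_degree G (node j) \<le> 1" if "m \<le> j" "j < q" for j
    using not_less_Least[of j "\<lambda>q. m \<le> q \<and> out_degree G (node q) \<le> 1"] that
    unfolding q_def by blast
  have mq: "m < q" using q out_m le_neq_implies_less by blast
  have qn: "q < ?n" using q_le m by linarith
  have links_A: "?m j \<in> A" if "m < j" "j \<le> q" for j
    using that
  proof (induction j)
    case (Suc j)
    have jn: "Suc j < ?n" using Suc.prems qn by simp
    have out_j: "\<not> out_degree G (node j) \<le> 1" using q_min Suc.prems by simp
    have leaving: "c = ?m (Suc j)" if "c \<in> A" "tail G c = \<sigma>\<^sub>V (node j)" for c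
      using in_arcs_node(2)[OF jn out_j] that sub by (metis in_mono in_out_arcs_conv singletonD)
    show ?case
    proof (cases "j = m")
      case True
      show ?thesis
      proof (cases "m = 0")
        case True
        then show ?thesis using m_cases link_1 \<open>j = m\<close> by simp
      next
        case False
        then show ?thesis using m_cases succ leaving \<open>j = m\<close> by metis
      qed
    next
      case False
      then have "?m j \<in> A" using Suc by simp
      moreover have "head G (?m j) = \<sigma>\<^sub>V (node j)" using mate_link[of j] False Suc.prems jn by simp
      ultimately show ?thesis using succ leaving by metis
    qed
  qed simp
  \<comment> \<open>\<open>C\<close> omits the arcs of \<open>A\<close> that start in
    \<open>T\<close>, except at the mate of \<open>node q\<close>. A walk in \<open>C\<close> from
    there can go on past a node of \<open>T\<close> only at its starting point, and neither the
    links up to \<open>q\<close> nor their mates belong to \<open>C\<close>.\<close>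
  define T where "T = node ` {..q} \<union> (\<lambda>j. \<sigma>\<^sub>V (node j)) ` {..q}"
  define C where "C = {a \<in> A. \<not> (tail G a \<in> X \<and> head G a \<in> X) \<and>
    (tail trimmed a \<notin> T \<or> tail trimmed a = \<sigma>\<^sub>V (node q))}"
  have CT: "C \<subseteq> arcs trimmed" "C \<subseteq> A" using sub by (auto simp: C_def arcs_trim)
  have q_notin: "node q \<notin> X" "\<sigma>\<^sub>V (node q) \<notin> X" using node_notin_X[of q] mq qn by auto
  have u_T: "u \<in> T" "\<sigma>\<^sub>V u \<in> T"
    using node_0 by (auto simp: T_def)
  \<comment> \<open>Otherwise the arcs of \<open>C\<close> reachable from the mate of
    \<open>node q\<close> form a successor-closed set in the trimmed graph: their heads avoid
    \<open>T\<close>, hence also both remaining nodes of \<open>X\<close>, so no redirection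
    interferes.\<close>
  have "\<exists>t \<in> T. (\<sigma>\<^sub>V (node q), t) \<in> (arc_rel trimmed C)\<^sup>+"
  proof (rule ccontr)
    assume no_return: "\<not> ?thesis"
    define D where "D = {a \<in> C. (\<sigma>\<^sub>V (node q), head trimmed a) \<in> (arc_rel trimmed C)\<^sup>+}"
    have "head G (?m q) = \<sigma>\<^sub>V (node q)" "?m q \<in> A" using mate_link[of q] links_A mq qn by auto
    then obtain a0 where a0: "a0 \<in> A" "tail G a0 = \<sigma>\<^sub>V (node q)" using succ by metis
    then have a0T: "a0 \<in> arcs trimmed" "tail trimmed a0 = \<sigma>\<^sub>V (node q)"
      using sub q_notin by (auto simp: arcs_trim tail_trim)
    then have "a0 \<in> C" using a0 q_notin by (simp add: C_def)
    then have "(tail trimmed a0, head trimmed a0) \<in> (arc_rel trimmed C)\<^sup>+"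
      by (intro r_into_trancl arc_relI)
    then have "a0 \<in> D" using \<open>a0 \<in> C\<close> a0T by (simp add: D_def)
    moreover have "\<exists>c \<in> D. tail trimmed c = head trimmed a" if a: "a \<in> D" for a
    proof -
      have aC: "a \<in> C" and reach: "(\<sigma>\<^sub>V (node q), head trimmed a) \<in> (arc_rel trimmed C)\<^sup>+"
        using a by (auto simp: D_def)
      then have hT: "head trimmed a \<notin> T" using no_return by blast
      have aT: "a \<in> arcs trimmed" using aC CT by blast
      have hX: "head G a \<notin> X"
      proof
        assume "head G a \<in> X"
        then have "head trimmed a = \<sigma>\<^sub>V u \<or> head trimmed a = u"
          using aT head_b by (simp add: head_trim)
        then show False using hT u_T by metis
      qed
      then have h: "head trimmed a = head G a" using aT by (simp add: head_trim)
      obtain c where c: "c \<in> A" "tail G c = head G a" using succ aC by (auto simp: C_def)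
      then have cT: "c \<in> arcs trimmed" "tail trimmed c = head trimmed a"
        using sub hX h by (auto simp: arcs_trim tail_trim)
      then have "c \<in> C" using c hX hT by (simp add: C_def)
      then have "(tail trimmed c, head trimmed c) \<in> arc_rel trimmed C" by (rule arc_relI)
      with reach cT have "(\<sigma>\<^sub>V (node q), head trimmed c) \<in> (arc_rel trimmed C)\<^sup>+" by simp
      then show ?thesis using \<open>c \<in> C\<close> cT by (auto simp: D_def)
    qed
    moreover have "D \<subseteq> arcs trimmed" "mate_free \<sigma>\<^sub>A D"
      using CT mate_free_subset[OF free, of D] by (auto simp: D_def)
    ultimately show False
      using T.successor_closed_imp_not_weakly_acyclic[of D] wa by blast
  qed
  then obtain t where t: "t \<in> T" "(\<sigma>\<^sub>V (node q), t) \<in> (arc_rel trimmed C)\<^sup>+" by blast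
  have link_C: "link j \<notin> C" if "0 < j" "j \<le> q" for j
  proof
    assume "link j \<in> C"
    moreover have "tail trimmed (link j) = node j" using link_trimmed that qn by simp
    moreover have "node j \<in> T" using that by (simp add: T_def)
    moreover have "node j \<noteq> \<sigma>\<^sub>V (node q)" using node_neq_mate that qn by simp
    ultimately show False by (simp add: C_def)
  qed
  have mate_link_C: "?m j \<notin> C" if "0 < j" "j \<le> q" for j
  proof
    assume "?m j \<in> C"
    moreover have "tail trimmed (?m j) = \<sigma>\<^sub>V (node (j - 1))" using mate_link_trimmed that qn by simp
    moreover have "\<sigma>\<^sub>V (node (j - 1)) \<in> T" using that by (auto simp: T_def)
    moreover have "\<sigma>\<^sub>V (node (j - 1)) \<noteq> \<sigma>\<^sub>V (node q)" using mate_node_inj[of "j - 1" q] that qn by simp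
    ultimately show False by (simp add: C_def)
  qed
  have link_F: "link j \<in> F" "?m j \<notin> F" "\<sigma>\<^sub>A (?m j) = link j" if "0 < j" "j \<le> q" for j
    using link[of j] that qn mate_not_F F_arcs arc_mate_mate by auto
  have CA: "\<sigma>\<^sub>A c \<in> C \<Longrightarrow> c \<notin> C" for c
    using CT free by (auto simp: mate_free_def)
  from t(1) consider (anti) i where "t = \<sigma>\<^sub>V (node i)" "i \<le> q" | (gray) i where "t = node i" "i \<le> q"
    by (auto simp: T_def)
  then show False
  proof cases
    case anti
    \<comment> \<open>The walk is closed by the mates of the links from \<open>i\<close> to
      \<open>q\<close>. For indices up to \<open>m\<close> these need not belong to
      \<open>A\<close>, so freedom from mates is checked against the forest.\<close>
    let ?E = "C \<union> ?m ` {i<..q}"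
    have "(\<sigma>\<^sub>V (node i), \<sigma>\<^sub>V (node q)) \<in> (arc_rel trimmed ?E)\<^sup>*"
      using mate_stack_path_trimmed[OF anti(2) qn] by (rule arc_rel_rtrancl_mono) simp
    moreover have "(\<sigma>\<^sub>V (node q), \<sigma>\<^sub>V (node i)) \<in> (arc_rel trimmed ?E)\<^sup>+"
      using t(2) anti(1) by (auto intro: arc_rel_trancl_mono)
    ultimately have "(\<sigma>\<^sub>V (node i), \<sigma>\<^sub>V (node i)) \<in> (arc_rel trimmed ?E)\<^sup>+"
      by (rule rtrancl_trancl_trancl)
    moreover have "?E \<subseteq> arcs trimmed"
      using CT mate_link_trimmed qn by auto
    moreover have "mate_free \<sigma>\<^sub>A ?E"
      unfolding mate_free_def
    proof
      fix a assume "a \<in> ?E"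
      then show "\<sigma>\<^sub>A a \<notin> ?E"
      proof
        assume a: "a \<in> C"
        have "\<sigma>\<^sub>A a \<notin> ?m ` {i<..q}"
        proof
          assume "\<sigma>\<^sub>A a \<in> ?m ` {i<..q}"
          then obtain j where j: "\<sigma>\<^sub>A a = ?m j" "0 < j" "j \<le> q" by auto
          have "\<sigma>\<^sub>A (\<sigma>\<^sub>A a) = a" using a CT(2) sub arc_mate_mate by blast
          then have "a = link j" using link_F(3)[OF j(2,3)] j(1) by metis
          then show False using link_C j a by blast
        qed
        then show ?thesis using a CA by blast
      next
        assume "a \<in> ?m ` {i<..q}"
        then obtain j where j: "a = ?m j" "0 < j" "j \<le> q" by auto
        then have "\<sigma>\<^sub>A a = link j" using link_F(3)[of j] by simp
        moreover have "link j \<notin> ?m ` {i<..q}"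
          using link_F(1)[of j] link_F(2) j by force
        ultimately show ?thesis using link_C j by simp
      qed
    qed
    ultimately show False using T.not_weakly_acyclicI wa by blast
  next
    case gray
    show False
    proof (cases "i \<le> m")
      case True
      \<comment> \<open>The circuit runs along the stack from \<open>node i\<close> to
        \<open>u\<close>, through the black run to the mate of \<open>node m\<close>, along mates of
        links to the mate of \<open>node q\<close> and through \<open>C\<close> back. The condition
        \<open>i \<le> m\<close> keeps the indices of the links disjoint from those of the mates of
        links.\<close>
      let ?E = "(C \<union> B \<union> ?m ` {m<..q}) \<union> link ` {1..i}"
      have "(node i, u) \<in> (arc_rel trimmed ?E)\<^sup>*"
        using stack_path_trimmed by (rule arc_rel_rtrancl_mono) (use True m in auto)
      also have "(u, \<sigma>\<^sub>V (node m)) \<in> (arc_rel trimmed ?E)\<^sup>+"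
        using black_run by (rule arc_rel_trancl_mono) auto
      also have "(\<sigma>\<^sub>V (node m), \<sigma>\<^sub>V (node q)) \<in> (arc_rel trimmed ?E)\<^sup>*"
        using mate_stack_path_trimmed[OF q(1) qn] by (rule arc_rel_rtrancl_mono) auto
      also have "(\<sigma>\<^sub>V (node q), node i) \<in> (arc_rel trimmed ?E)\<^sup>+"
        using t(2) gray(1) by (auto intro: arc_rel_trancl_mono)
      finally have "(node i, node i) \<in> (arc_rel trimmed ?E)\<^sup>+" .
      moreover have "?E \<subseteq> arcs trimmed"
        using CT mate_link_trimmed link_trimmed qn True mq sub by (auto simp: B_def arcs_trim)
      moreover have "mate_free \<sigma>\<^sub>A ?E"
      proof -
        have inA: "C \<union> B \<union> ?m ` {m<..q} \<subseteq> A"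
          using CT links_A by (auto simp: B_def)
        have not_mate: "?m j \<notin> ?E" if "j \<in> {1..i}" for j
        proof -
          have j: "0 < j" "j \<le> q" "j \<le> m" using that True mq by auto
          then have "tail G (?m j) = \<sigma>\<^sub>V (node (j - 1))" "j - 1 < ?n" using mate_link qn by auto
          then have "?m j \<notin> B" using mate_node(2)[of "j - 1"] by (auto simp: B_def)
          moreover have "?m j \<notin> ?m ` {m<..q}"
          proof
            assume "?m j \<in> ?m ` {m<..q}"
            then obtain k where k: "?m j = ?m k" "m < k" "k \<le> q" by auto
            moreover have "head G (?m j) = \<sigma>\<^sub>V (node j)" "head G (?m k) = \<sigma>\<^sub>V (node k)"
              using mate_link[of j] mate_link[of k] j k qn by auto
            ultimately show False using mate_node_inj[of j k] j qn by auto
          qed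
          moreover have "link ` {1..i} \<subseteq> F"
            using link_F(1) True mq by auto
          then have "?m j \<notin> link ` {1..i}"
            using link_F(2)[OF j(1,2)] by blast
          ultimately show ?thesis using mate_link_C[OF j(1,2)] by blast
        qed
        show ?thesis
          unfolding mate_free_def
        proof
          fix a assume "a \<in> ?E"
          then show "\<sigma>\<^sub>A a \<notin> ?E"
          proof
            assume a: "a \<in> C \<union> B \<union> ?m ` {m<..q}"
            have "\<sigma>\<^sub>A a \<notin> link ` {1..i}"
            proof
              assume "\<sigma>\<^sub>A a \<in> link ` {1..i}"
              then obtain j where j: "\<sigma>\<^sub>A a = link j" "j \<in> {1..i}" by blast
              have "\<sigma>\<^sub>A (\<sigma>\<^sub>A a) = a" using a inA sub arc_mate_mate by blast
              then have "a = ?m j" using j by simp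
              then show False using not_mate[OF j(2)] \<open>a \<in> ?E\<close> by simp
            qed
            moreover have "\<sigma>\<^sub>A a \<notin> A" using a inA free by (auto simp: mate_free_def)
            ultimately show ?thesis using inA by blast
          next
            assume "a \<in> link ` {1..i}"
            then show ?thesis using not_mate by blast
          qed
        qed
      qed
      ultimately show False using T.not_weakly_acyclicI wa by blast
    next
      case False
      \<comment> \<open>This case is impossible. The circulation contains the mates of the links
        with indices from \<open>m + 1\<close> to \<open>q\<close>; but it has to enter
        \<open>node i\<close> through \<open>link (i + 1)\<close> or, if \<open>i = q\<close>, to go
        on along \<open>link q\<close>.\<close>
      then have i: "0 < i" "m < i" "i < ?n" using gray qn by auto
      from t(2) obtain x where "(x, t) \<in> arc_rel trimmed C" by (auto elim: tranclE)
      then obtain a where a: "a \<in> C" "head trimmed a = node i" using gray(1) by (auto elim: arc_relE)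
      then have aT: "a \<in> arcs trimmed" "a \<in> A" using CT by auto
      have "node i \<noteq> \<sigma>\<^sub>V u" using node_gray(1)[OF i(3)] mate_u(3) by auto
      then have ha: "head G a = node i"
        using a aT head_b by (auto simp: head_trim split: if_splits)
      have mi: "?m i \<in> A" using links_A i gray by simp
      show False
      proof (cases "i = q")
        case True
        obtain c where c: "c \<in> A" "tail G c = node q" using succ aT ha True by metis
        have "card (out_arcs G (node q)) \<le> Suc 0" using q(2) by (simp add: out_degree_def)
        moreover have "c \<in> out_arcs G (node q)" "link q \<in> out_arcs G (node q)"
          using c sub link[of q] i True F_arcs by auto
        ultimately have "c = link q" by (metis card_le_Suc0_iff_eq finite_out_arcs)
        then show False using mi True c link_F(3)[of q] i free by (auto simp: mate_free_def)
      next
        case False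
        then have "i < q" using gray by simp
        then have "\<not> out_degree G (node i) \<le> 1" using q_min i by simp
        then have "in_arcs G (node i) = {link (Suc i)}"
          using in_arcs_node(1) \<open>i < q\<close> qn by simp
        moreover have "a \<in> in_arcs G (node i)" using ha aT sub by auto
        ultimately have "a = link (Suc i)" by blast
        moreover have "?m (Suc i) \<in> A" using links_A i \<open>i < q\<close> by simp
        ultimately show False using aT free by (auto simp: mate_free_def)
      qed
    qed
  qed
qed

text \<open>An entrance at an antiblack node is the mate of a black exit of the mate circulation. So
  \<open>A\<close> or its mate has a black exit, or \<open>A\<close> can be restricted
  directly.\<close>

lemma trimmed_not_weakly_acyclic:
  assumes "\<not> weakly_acyclic \<sigma>\<^sub>A G"
  shows "\<not> weakly_acyclic \<sigma>\<^sub>A trimmed"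
proof -
  from assms obtain A where A: "circulation \<sigma>\<^sub>A G A" by (rule not_weakly_acyclicE)
  consider "black_exits A \<noteq> {}" | "black_exits (\<sigma>\<^sub>A ` A) \<noteq> {}"
    | "black_exits A = {}" "black_exits (\<sigma>\<^sub>A ` A) = {}" by blast
  then show ?thesis
  proof cases
    case 3
    have "colr (head G a) \<noteq> Antiblack" if a: "a \<in> A" "tail G a \<notin> X" "head G a \<in> X" for a
    proof
      assume anti: "colr (head G a) = Antiblack"
      have "a \<in> arcs G" using A a by (auto simp: circulation_def)
      then have "\<sigma>\<^sub>A a \<in> black_exits (\<sigma>\<^sub>A ` A)"
        using a anti by (simp add: black_exits_def tail_mate head_mate X_mate_iff)
      then show False using 3 by simp
    qed
    then show ?thesis using circulation_trimmed_direct A 3 by blast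
  qed (use circulation_trimmed_exit A circulation_mate in blast)+
qed

lemma weakly_acyclic_trimmed_iff: "weakly_acyclic \<sigma>\<^sub>A trimmed \<longleftrightarrow> weakly_acyclic \<sigma>\<^sub>A G"
  using trimmed_not_weakly_acyclic lift_not_weakly_acyclic by blast

end

section \<open>Invariance under the steps of the search\<close>

lemma search_initial:
  assumes "skew_symmetric_graph G \<sigma>\<^sub>V \<sigma>\<^sub>A" "degree_property G" "loop_property \<sigma>\<^sub>V G"
  shows "search G \<sigma>\<^sub>V \<sigma>\<^sub>A {} (\<lambda>_. White) [] r"
proof -
  interpret skew_symmetric_graph G \<sigma>\<^sub>V \<sigma>\<^sub>A by fact
  show ?thesis by unfold_locales (use assms in auto)
qed

section \<open>Recording a scanned arc, entering a call, returning from a call\<close>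

context search
begin

text \<open>The frame may lie below others, since an arc to a white head is recorded at the caller
  after the callee has been pushed. The conditions speak of \<open>a\<close> only as an arc of the
  graph, because the arc that reveals a blossom is recorded after the trimming that deletes it. The
  clause on black heads expresses that such a head turned black before the gray nodes above
  \<open>u\<close> on the stack were entered.\<close>

lemma search_insert_scanned:
  assumes stk: "stk = xs @ (u, S) # cs"
    and tail_a: "a \<in> arcs G \<Longrightarrow> tail G a = u"
    and head_a: "a \<in> arcs G \<Longrightarrow> colr (head G a) = Black \<and>
        (\<forall>w \<in> verts G. colr w = Gray \<longrightarrow> r u < r w \<longrightarrow> r (head G a) < r w) \<or>
      colr (head G a) = Antigray \<and> r (\<sigma>\<^sub>V (head G a)) < r u \<or>
      colr (head G a) = Gray \<and> a \<in> F \<and> r u < r (head G a)"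
  shows "search G \<sigma>\<^sub>V \<sigma>\<^sub>A F colr (xs @ (u, insert a S) # cs) r"
proof -
  let ?stk = "xs @ (u, insert a S) # cs"
  have fst_eq: "map fst ?stk = map fst stk" by (simp add: stk)
  have len: "length ?stk = length stk" by (simp add: stk)
  have nth: "fst (?stk ! i) = fst (stk ! i)" if "i < length stk" for i
    using fst_eq len that by (metis nth_map)
  have last: "fst (last ?stk) = fst (last stk)" by (simp add: stk)
  show ?thesis
  proof
    show "fst ` set ?stk = {v \<in> verts G. colr v = Gray}"
      using gray_stack by (simp add: stk)
    show "sorted_wrt (\<lambda>x y. r y < r x) (map fst ?stk)"
      using stack_sorted by (simp only: fst_eq)
    show "\<exists>g\<in>F. tail G g = fst (?stk ! Suc i) \<and> head G g = fst (?stk ! i)" if "Suc i < length ?stk" for i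
      using F_stack[of i] nth[of i] nth[of "Suc i"] that len by simp
    show "out_degree G (fst (last ?stk)) \<le> 1"
      using root last by (simp add: stk)
    fix x T c assume x: "(x, T) \<in> set ?stk" "c \<in> T" "c \<in> arcs G"
    then consider T' where "(x, T') \<in> set stk" "c \<in> T'" | "x = u" "c = a"
      by (auto simp: stk)
    then have "tail G c = x \<and> (colr (head G c) = Black \<and>
        (\<forall>w \<in> verts G. colr w = Gray \<longrightarrow> r x < r w \<longrightarrow> r (head G c) < r w) \<or>
      colr (head G c) = Antigray \<and> r (\<sigma>\<^sub>V (head G c)) < r x \<or>
      colr (head G c) = Gray \<and> c \<in> F \<and> r x < r (head G c))"
    proof cases
      case 1
      then show ?thesis using scanned scanned_tail x(3) by blast
    next
      case 2
      then show ?thesis using tail_a head_a x(3) by blast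
    qed
    then show "tail G c = x" "colr (head G c) = Black \<and>
        (\<forall>w \<in> verts G. colr w = Gray \<longrightarrow> r x < r w \<longrightarrow> r (head G c) < r w) \<or>
      colr (head G c) = Antigray \<and> r (\<sigma>\<^sub>V (head G c)) < r x \<or>
      colr (head G c) = Gray \<and> c \<in> F \<and> r x < r (head G c)"
      by blast+
  qed (use degree loop colr_mate r_inj F_sub F_colr F_inj F_reach black_arc in \<open>simp_all\<close>)
qed

lemma top_gray: "stk = (u, S) # cs \<Longrightarrow> colr u = Gray \<and> u \<in> verts G"
  using stk_gray[of 0] by simp

lemma gray_le_top: "\<lbrakk>stk = (u, S) # cs; w \<in> verts G; colr w = Gray\<rbrakk> \<Longrightarrow> r w \<le> r u"
proof -
  assume stk: "stk = (u, S) # cs" and "w \<in> verts G" "colr w = Gray"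
  then obtain i where "i < length stk" "w = fst (stk ! i)" using gray_in_stk by metis
  then show "r w \<le> r u"
    using stk_r_less[of 0 i] by (cases "i = 0") (auto simp: stk)
qed

text \<open>The new node receives the largest rank. It is a leaf of the forest, attached to the
  former top if there is one, which every gray node reaches; so reachability and ranks stay in
  agreement.\<close>

lemma search_enter:
  assumes v: "v \<in> verts G" "colr v = White" and t: "\<And>w. w \<in> verts G \<Longrightarrow> r w < t"
    and q: "case q of None \<Rightarrow> stk = [] \<and> out_degree G v \<le> 1
      | Some a \<Rightarrow> stk \<noteq> [] \<and> a \<in> arcs G \<and> tail G a = fst (hd stk) \<and> head G a = v"
  shows "search G \<sigma>\<^sub>V \<sigma>\<^sub>A (F \<union> set_option q) (colr(v := Gray, \<sigma>\<^sub>V v := Antigray)) ((v, {}) # stk) (r(v := t))"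
proof -
  let ?c = "colr(v := Gray, \<sigma>\<^sub>V v := Antigray)" and ?r = "r(v := t)" and ?F = "F \<union> set_option q"
  have mv: "\<sigma>\<^sub>V v \<in> verts G" "colr (\<sigma>\<^sub>V v) = White" "\<sigma>\<^sub>V v \<noteq> v" "\<sigma>\<^sub>V (\<sigma>\<^sub>V v) = v"
    using v node_mate_in node_mate_neq node_mate_mate by auto
  have c_gray: "?c w = Gray \<longleftrightarrow> colr w = Gray \<or> w = v" for w using mv v by auto
  have c_black: "?c w = Black \<longleftrightarrow> colr w = Black" for w using mv v by auto
  have c_anti: "?c w = Antigray \<longleftrightarrow> colr w = Antigray \<or> w = \<sigma>\<^sub>V v" for w using mv v by auto
  have F_v: "tail G a \<noteq> v" "head G a \<noteq> v" if "a \<in> F" for a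
    using F_colr[OF that] v by auto
  have q_F: "a \<in> arcs G \<and> tail G a = fst (hd stk) \<and> head G a = v \<and> stk \<noteq> []" if "a \<in> set_option q" for a
    using that q by (auto split: option.splits)
  have hd_gray: "fst (hd stk) \<in> verts G" "colr (fst (hd stk)) = Gray" "fst (hd stk) = fst (stk ! 0)" if "stk \<noteq> []"
    using that stk_gray[of 0] by (simp_all add: hd_conv_nth)
  have r_hd: "r w \<le> r (fst (hd stk))" if "w \<in> verts G" "colr w = Gray" for w
    using that gray_le_top[of "fst (hd stk)" "snd (hd stk)" "tl stk" w] by (cases stk) (auto elim: gray_in_stk)
  show ?thesis
  proof
    fix w assume w: "w \<in> verts G"
    show "?c (\<sigma>\<^sub>V w) = mate_colour (?c w)"
    proof (cases "w = v \<or> w = \<sigma>\<^sub>V v")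
      case False
      then have "\<sigma>\<^sub>V w \<noteq> v" "\<sigma>\<^sub>V w \<noteq> \<sigma>\<^sub>V v" using w v node_mate_mate by metis+
      then show ?thesis using False w colr_mate by simp
    qed (use mv in auto)
  next
    show "fst ` set ((v, {}) # stk) = {w \<in> verts G. ?c w = Gray}"
      unfolding c_gray using gray_stack v by auto
    show "sorted_wrt (\<lambda>x y. ?r y < ?r x) (map fst ((v, {}) # stk))"
    proof -
      have x: "x \<noteq> v \<and> x \<in> verts G" if "x \<in> set (map fst stk)" for x
        using that gray_stack v by auto
      have "sorted_wrt (\<lambda>x y. ?r y < ?r x) (map fst stk)"
        using _ stack_sorted by (rule sorted_wrt_mono_rel) (use x in simp)
      then show ?thesis using x t by simp
    qed
    show "inj_on ?r {w \<in> verts G. ?c w \<in> {Gray, Black}}"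
    proof (rule inj_onI)
      fix x y assume "x \<in> {w \<in> verts G. ?c w \<in> {Gray, Black}}" "y \<in> {w \<in> verts G. ?c w \<in> {Gray, Black}}" "?r x = ?r y"
      then show "x = y"
        using t[of x] t[of y] inj_onD[OF r_inj, of x y] c_gray c_black by (cases "x = v"; cases "y = v") auto
    qed
    show "?F \<subseteq> arcs G" using F_sub q_F by blast
    show "inj_on (head G) ?F"
    proof (cases q)
      case (Some a)
      then have "head G a \<notin> head G ` F" using q F_v(2) by force
      then show ?thesis using F_inj Some by (simp add: inj_on_insert) blast
    qed (use F_inj in simp)
  next
    fix a assume a: "a \<in> ?F"
    have forest: "?c x \<in> {Gray, Black}" if "colr x \<in> {Gray, Black} \<or> x = v" for x
      using that c_gray c_black by blast
    from a consider "a \<in> F" | "a \<in> set_option q" by blast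
    then have "colr (tail G a) \<in> {Gray, Black} \<and> (colr (head G a) \<in> {Gray, Black} \<or> head G a = v)"
      using F_colr[of a] q_F[of a] hd_gray by cases simp_all
    then show "?c (tail G a) \<in> {Gray, Black} \<and> ?c (head G a) \<in> {Gray, Black}"
      using forest by blast
  next
    fix i assume i: "Suc i < length ((v, {}) # stk)"
    show "\<exists>g\<in>?F. tail G g = fst (((v, {}) # stk) ! Suc i) \<and> head G g = fst (((v, {}) # stk) ! i)"
    proof (cases i)
      case 0
      then show ?thesis using i q hd_gray by (cases q) auto
    next
      case (Suc j)
      then show ?thesis using i F_stack[of j] by auto
    qed
  next
    show "out_degree G (fst (last ((v, {}) # stk))) \<le> 1"
      using root q by (cases q) auto
  next
    fix w y assume w: "w \<in> verts G" "?c w = Gray" and y: "y \<in> verts G" "?c y \<in> {Gray, Black}"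
    have from_v: "(v, y) \<in> (arc_rel G F)\<^sup>* \<Longrightarrow> y = v"
      by (metis F_v(1) arc_relE converse_rtranclE)
    show "(w, y) \<in> (arc_rel G ?F)\<^sup>* \<longleftrightarrow> ?r w \<le> ?r y"
    proof (cases q)
      case None
      then have "stk = []" using q by simp
      then have "colr w \<noteq> Gray" using gray_stack w(1) by auto
      then have "w = v" using w(2) c_gray by blast
      then show ?thesis using None from_v t[OF y(1)] by (cases "y = v") auto
    next
      case (Some a)
      let ?u = "fst (hd stk)"
      have a: "stk \<noteq> []" "tail G a = ?u" "head G a = v" using q Some by auto
      have "arc_rel G ?F = insert (?u, v) (arc_rel G F)"
        using a Some by (auto simp: arc_rel_def)
      then have iff: "(w, y) \<in> (arc_rel G ?F)\<^sup>* \<longleftrightarrow>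
          (w, y) \<in> (arc_rel G F)\<^sup>* \<or> (w, ?u) \<in> (arc_rel G F)\<^sup>* \<and> (v, y) \<in> (arc_rel G F)\<^sup>*"
        by (simp add: rtrancl_insert)
      show ?thesis
      proof (cases "w = v")
        case True
        then show ?thesis using iff from_v t[OF y(1)] by (cases "y = v") auto
      next
        case False
        then have wg: "colr w = Gray" using w c_gray by blast
        show ?thesis
        proof (cases "y = v")
          case True
          have "(w, ?u) \<in> (arc_rel G F)\<^sup>*"
            using F_reach[of w ?u] w wg hd_gray[OF a(1)] r_hd by simp
          then show ?thesis using iff True False t[OF w(1)] by simp
        next
          case yv: False
          then have "colr y \<in> {Gray, Black}" using y c_gray c_black by blast
          then show ?thesis using iff from_v yv False F_reach[of w y] w wg y by auto
        qed
      qed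
    qed
  next
    fix a assume a: "a \<in> arcs G" "?c (tail G a) = Black"
    then have "colr (tail G a) = Black" using c_black by blast
    then have "colr (head G a) = Black \<and> r (head G a) < r (tail G a) \<or>
      colr (head G a) = Antigray \<and> r (\<sigma>\<^sub>V (head G a)) < r (tail G a)" "tail G a \<noteq> v"
      using black_arc a v by auto
    then show "?c (head G a) = Black \<and> ?r (head G a) < ?r (tail G a) \<or>
      ?c (head G a) = Antigray \<and> ?r (\<sigma>\<^sub>V (head G a)) < ?r (tail G a)"
      using v mv a node_mate_mate[of "head G a"] by auto
  next
    fix x T c assume "(x, T) \<in> set ((v, {}) # stk)" "c \<in> T" and c: "c \<in> arcs G"
    then have x: "(x, T) \<in> set stk" "c \<in> T" by auto
    show "tail G c = x" using scanned_tail x c by blast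
    have "x \<in> fst ` set stk" using x by force
    then have "x \<noteq> v" "x \<in> verts G" using gray_stack v by auto
    \<comment> \<open>Neither the head of a scanned arc nor its mate is white, so the two nodes
      recoloured here are not among these heads.\<close>
    moreover have "colr (head G c) = White \<longleftrightarrow> False" "colr (\<sigma>\<^sub>V (head G c)) = White \<longleftrightarrow> False"
      using scanned[OF x c] c by auto
    ultimately show "?c (head G c) = Black \<and>
        (\<forall>w \<in> verts G. ?c w = Gray \<longrightarrow> ?r x < ?r w \<longrightarrow> ?r (head G c) < ?r w) \<or>
      ?c (head G c) = Antigray \<and> ?r (\<sigma>\<^sub>V (head G c)) < ?r x \<or>
      ?c (head G c) = Gray \<and> c \<in> ?F \<and> ?r x < ?r (head G c)"
      using scanned[OF x c] v mv c t by auto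
  qed (fact degree loop)+
qed

text \<open>Once all arcs leaving \<open>u\<close> are scanned, their heads are black or mates of
  gray nodes below \<open>u\<close> on the stack; a gray head would outrank the top of the stack.
  Giving \<open>u\<close> the largest rank makes all these arcs descend.\<close>

lemma search_return:
  assumes stk: "stk = (u, S) # cs" and complete: "out_arcs G u \<subseteq> S" and t: "\<And>w. w \<in> verts G \<Longrightarrow> r w < t"
  shows "search G \<sigma>\<^sub>V \<sigma>\<^sub>A F (colr(u := Black, \<sigma>\<^sub>V u := Antiblack)) cs (r(u := t))"
proof -
  let ?c = "colr(u := Black, \<sigma>\<^sub>V u := Antiblack)" and ?r = "r(u := t)"
  have u: "u \<in> verts G" "colr u = Gray" using top_gray[OF stk] by auto
  then have mu: "\<sigma>\<^sub>V u \<in> verts G" "colr (\<sigma>\<^sub>V u) = Antigray" "\<sigma>\<^sub>V u \<noteq> u" "\<sigma>\<^sub>V (\<sigma>\<^sub>V u) = u"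
    using node_mate_in node_mate_neq node_mate_mate by auto
  have c_gray: "?c w = Gray \<longleftrightarrow> colr w = Gray \<and> w \<noteq> u" for w using mu u by auto
  have c_black: "?c w = Black \<longleftrightarrow> colr w = Black \<or> w = u" for w using mu u by auto
  have c_anti: "?c w = Antigray \<longleftrightarrow> colr w = Antigray \<and> w \<noteq> \<sigma>\<^sub>V u" for w using mu u by auto
  have c_forest: "?c w \<in> {Gray, Black} \<longleftrightarrow> colr w \<in> {Gray, Black}" for w using mu u by auto
  have cs_sub: "set cs \<subseteq> set stk" using stk by auto
  have r_u: "r w < r u" if "w \<in> verts G" "colr w = Gray" "w \<noteq> u" for w
    using gray_le_top[OF stk that(1,2)] that u inj_onD[OF r_inj, of w u] by fastforce
  have cs_less: "r x < r u \<and> x \<noteq> u \<and> x \<in> verts G \<and> colr x = Gray" if "x \<in> fst ` set cs" for x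
    using that stack_sorted gray_stack by (force simp: stk)
  have scanned_u: "c \<in> S" if "c \<in> arcs G" "tail G c = u" for c using that complete by auto
  show ?thesis
  proof
    fix w assume w: "w \<in> verts G"
    show "?c (\<sigma>\<^sub>V w) = mate_colour (?c w)"
    proof (cases "w = u \<or> w = \<sigma>\<^sub>V u")
      case False
      then have "\<sigma>\<^sub>V w \<noteq> u" "\<sigma>\<^sub>V w \<noteq> \<sigma>\<^sub>V u" using w u node_mate_mate by metis+
      then show ?thesis using False w colr_mate by simp
    qed (use mu in auto)
  next
    show "fst ` set cs = {w \<in> verts G. ?c w = Gray}"
    proof -
      have "fst ` set cs = fst ` set stk - {u}" using cs_less stk by auto
      then show ?thesis unfolding c_gray gray_stack by blast
    qed
    show "sorted_wrt (\<lambda>x y. ?r y < ?r x) (map fst cs)"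
    proof (rule sorted_wrt_mono_rel)
      show "sorted_wrt (\<lambda>x y. r y < r x) (map fst cs)" using stack_sorted stk by simp
      fix x y assume "x \<in> set (map fst cs)" "y \<in> set (map fst cs)" "r y < r x"
      then show "?r y < ?r x" using cs_less by auto
    qed
    show "inj_on ?r {w \<in> verts G. ?c w \<in> {Gray, Black}}"
    proof (rule inj_onI)
      fix x y assume "x \<in> {w \<in> verts G. ?c w \<in> {Gray, Black}}" "y \<in> {w \<in> verts G. ?c w \<in> {Gray, Black}}" "?r x = ?r y"
      then show "x = y"
        using t[of x] t[of y] inj_onD[OF r_inj, of x y] c_forest[of x] c_forest[of y]
        by (cases "x = u"; cases "y = u") auto
    qed
    show "?c (tail G a) \<in> {Gray, Black} \<and> ?c (head G a) \<in> {Gray, Black}" if "a \<in> F" for a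
      using F_colr[OF that] c_forest by blast
    show "\<exists>g\<in>F. tail G g = fst (cs ! Suc i) \<and> head G g = fst (cs ! i)" if "Suc i < length cs" for i
      using F_stack[of "Suc i"] that stk by simp
    show "out_degree G (fst (last cs)) \<le> 1" if "cs \<noteq> []"
      using root that stk by simp
  next
    fix w y assume w: "w \<in> verts G" "?c w = Gray" and y: "y \<in> verts G" "?c y \<in> {Gray, Black}"
    then have "(w, y) \<in> (arc_rel G F)\<^sup>* \<longleftrightarrow> r w \<le> r y" "w \<noteq> u"
      using F_reach[of w y] c_gray c_forest by auto
    moreover have "r w < r u" using w c_gray r_u by blast
    ultimately show "(w, y) \<in> (arc_rel G F)\<^sup>* \<longleftrightarrow> ?r w \<le> ?r y"
      using t[OF w(1)] by (cases "y = u") auto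
  next
    fix a assume a: "a \<in> arcs G" "?c (tail G a) = Black"
    show "?c (head G a) = Black \<and> ?r (head G a) < ?r (tail G a) \<or>
      ?c (head G a) = Antigray \<and> ?r (\<sigma>\<^sub>V (head G a)) < ?r (tail G a)"
    proof (cases "tail G a = u")
      case True
      then have "colr (head G a) = Black \<or> colr (head G a) = Antigray \<and> r (\<sigma>\<^sub>V (head G a)) < r u
          \<or> colr (head G a) = Gray \<and> r u < r (head G a)"
        using scanned[of u S a] scanned_u a stk by auto
      moreover have "\<not> r u < r (head G a)" if "colr (head G a) = Gray"
        using gray_le_top[OF stk _ that] a by fastforce
      moreover have "head G a \<noteq> \<sigma>\<^sub>V u" using no_arc_to_mate a True by metis
      ultimately have "colr (head G a) = Black \<and> head G a \<noteq> u \<or> colr (head G a) = Antigray \<and>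
          head G a \<noteq> \<sigma>\<^sub>V u"
        using u by auto
      moreover have "\<sigma>\<^sub>V (head G a) \<noteq> u" using \<open>head G a \<noteq> \<sigma>\<^sub>V u\<close> a node_mate_mate by (metis head_in_verts)
      ultimately show ?thesis
        using True t[of "head G a"] t[of "\<sigma>\<^sub>V (head G a)"] a node_mate_in u mu by auto
    next
      case False
      then have tb: "colr (tail G a) = Black" using a c_black by blast
      \<comment> \<open>An arc from a black node to the mate of \<open>u\<close> would have a mate
        from \<open>u\<close> to an antiblack node; but every arc leaving \<open>u\<close> is
        scanned, and no scanned arc still present has an antiblack head.\<close>
      have "head G a \<noteq> \<sigma>\<^sub>V u"
      proof
        assume h: "head G a = \<sigma>\<^sub>V u"
        have m: "\<sigma>\<^sub>A a \<in> arcs G" "tail G (\<sigma>\<^sub>A a) = u" "colr (head G (\<sigma>\<^sub>A a)) = Antiblack"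
          using a h tb mu by (simp_all add: arc_mate_in tail_mate head_mate)
        then show False using scanned[of u S "\<sigma>\<^sub>A a"] scanned_u stk by auto
      qed
      moreover then have "\<sigma>\<^sub>V (head G a) \<noteq> u" using a node_mate_mate by (metis head_in_verts)
      moreover have "head G a \<noteq> u" using black_arc[OF a(1) tb] u by auto
      ultimately show ?thesis using black_arc[OF a(1) tb] False by simp
    qed
  next
    fix x T c assume "(x, T) \<in> set cs" "c \<in> T" and c: "c \<in> arcs G"
    then have x: "(x, T) \<in> set stk" "c \<in> T" and xcs: "x \<in> fst ` set cs" using cs_sub by force+
    show tc: "tail G c = x" using scanned_tail x c by blast
    have xu: "r x < r u" "x \<noteq> u" "x \<in> verts G" "colr x = Gray" using cs_less[OF xcs] by auto
    have old: "colr (head G c) = Black \<and>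
        (\<forall>w \<in> verts G. colr w = Gray \<longrightarrow> r x < r w \<longrightarrow> r (head G c) < r w) \<or>
      colr (head G c) = Antigray \<and> r (\<sigma>\<^sub>V (head G c)) < r x \<or>
      colr (head G c) = Gray \<and> c \<in> F \<and> r x < r (head G c)"
      using scanned[OF x c] .
    show "?c (head G c) = Black \<and>
        (\<forall>w \<in> verts G. ?c w = Gray \<longrightarrow> ?r x < ?r w \<longrightarrow> ?r (head G c) < ?r w) \<or>
      ?c (head G c) = Antigray \<and> ?r (\<sigma>\<^sub>V (head G c)) < ?r x \<or>
      ?c (head G c) = Gray \<and> c \<in> F \<and> ?r x < ?r (head G c)"
    proof (cases "head G c = u")
      case True
      then have "c \<in> F" using old u by auto
      obtain k where k: "k < length stk" "x = fst (stk ! k)"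
        using gray_in_stk xu by metis
      then have l: "Suc 0 < length stk" using xu stk by (cases k) auto
      then obtain g where "g \<in> F" "tail G g = fst (stk ! Suc 0)" "head G g = u"
        using F_stack[of 0] stk by auto
      then have "x = fst (stk ! Suc 0)" using F_inj \<open>c \<in> F\<close> True tc by (metis inj_onD)
      \<comment> \<open>\<open>c\<close> is the forest arc into \<open>u\<close>, so
        \<open>x\<close> is the new top of the stack and no gray node outranks it; the clause on the
        head \<open>u\<close>, which now has the largest rank, becomes vacuous.\<close>
      have "r w \<le> r x" if w: "w \<in> verts G" "colr w = Gray" "w \<noteq> u" for w
      proof -
        obtain i where i: "i < length stk" "w = fst (stk ! i)" using gray_in_stk w by metis
        then have "i \<noteq> 0" using w(3) stk by (metis fst_conv nth_Cons_0)
        then show ?thesis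
          using stk_r_less[of "Suc 0" i] i \<open>x = fst (stk ! Suc 0)\<close> by (cases "i = Suc 0") auto
      qed
      then have "\<forall>w \<in> verts G. ?c w = Gray \<longrightarrow> \<not> ?r x < ?r w"
        using c_gray xu by fastforce
      then show ?thesis using c_black True by blast
    next
      case False
      have "\<sigma>\<^sub>V (head G c) \<noteq> u" if "r (\<sigma>\<^sub>V (head G c)) < r x" using that xu by auto
      moreover then have "head G c \<noteq> \<sigma>\<^sub>V u" if "r (\<sigma>\<^sub>V (head G c)) < r x" using that mu by auto
      moreover have "head G c \<noteq> \<sigma>\<^sub>V u" if "colr (head G c) = Gray" using that mu by auto
      ultimately show ?thesis using old False xu mu by auto
    qed
  qed (fact degree loop F_sub F_inj)+
qed

end

section \<open>The invariant of the search survives the trimming of a blossom\<close>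

context scan_blossom
begin

lemma P_iff: "x \<in> P \<longleftrightarrow> x \<in> X \<and> colr x \<in> {Gray, Black}"
proof
  assume "x \<in> P" then show "x \<in> X \<and> colr x \<in> {Gray, Black}" using P_forest X_eq by blast
next
  assume "x \<in> X \<and> colr x \<in> {Gray, Black}"
  then show "x \<in> P" using X_gray X_black u_in_P by blast
qed

text \<open>Heads are injective on \<open>F\<close>, and every node of \<open>P\<close> other than
  \<open>u\<close> already has its forest arc on \<open>p\<close>, with tail in
  \<open>P\<close>.\<close>

lemma F_entering:
  assumes a: "a \<in> F" "tail G a \<notin> X" "head G a \<in> X"
  shows "a = b"
proof (cases "head G a = u")
  case True
  then show ?thesis using entering_u F_arcs a by blast
next
  case False
  have "head G a \<in> P" using P_iff F_colr a by blast
  then have "head G a \<in> head G ` set p"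
    using awalk_verts_conv'[OF p_cas] False p_cas by (cases p) auto
  then obtain g where g: "g \<in> set p" "head G g = head G a" by force
  then have "g = a" using F_inj p_F a by (auto dest: inj_onD)
  moreover have "tail G g \<in> P"
    using g awalk_verts_conv[of u p] by auto
  ultimately show ?thesis using a P_iff by blast
qed

lemma F_trimmed:
  assumes a: "a \<in> F" "a \<notin> inside G X"
  shows "a \<in> arcs trimmed" "tail trimmed a = (if tail G a \<in> P then u else tail G a)"
    "head trimmed a = head G a" "tail G a \<notin> P \<Longrightarrow> tail G a \<notin> X" "head G a \<in> X \<Longrightarrow> a = b"
proof -
  show aT: "a \<in> arcs trimmed" using a F_arcs by (auto simp: arcs_trim inside_def)
  have t: "tail G a \<in> X \<longleftrightarrow> tail G a \<in> P" using P_iff F_colr a by blast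
  then show "tail G a \<notin> P \<Longrightarrow> tail G a \<notin> X" by blast
  have "a \<noteq> \<sigma>\<^sub>A b" using b_F mate_not_F a by blast
  then show "tail trimmed a = (if tail G a \<in> P then u else tail G a)"
    using aT t head_b by (simp add: tail_trim)
  show hb: "head G a \<in> X \<Longrightarrow> a = b"
    using F_entering a F_arcs by (auto simp: inside_def)
  then show "head trimmed a = head G a"
    using aT by (cases "head G a \<in> X") (auto simp: head_trim)
qed

text \<open>On the forest the trimming is the contraction of \<open>P\<close> to \<open>u\<close>:
  arcs inside \<open>X\<close> collapse and the others become arcs of the trimmed graph. Conversely,
  where a tail has been moved to \<open>u\<close>, the forest path from \<open>u\<close> to the
  original tail undoes the contraction.\<close>

lemma forest_reach_trimmed:
  assumes w: "w \<in> verts trimmed" "colr w \<in> {Gray, Black}" and y: "y \<in> verts trimmed" "colr y \<in> {Gray, Black}"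
  shows "(w, y) \<in> (arc_rel trimmed (F - inside G X))\<^sup>* \<longleftrightarrow> (w, y) \<in> (arc_rel G F)\<^sup>*"
proof
  let ?F = "F - inside G X"
  assume "(w, y) \<in> (arc_rel trimmed ?F)\<^sup>*"
  moreover have "arc_rel trimmed ?F \<subseteq> (arc_rel G F)\<^sup>*"
  proof safe
    fix x z assume "(x, z) \<in> arc_rel trimmed ?F"
    then obtain a where a: "a \<in> F" "a \<notin> inside G X" "tail trimmed a = x" "head trimmed a = z"
      by (auto elim: arc_relE)
    then have "(tail G a, z) \<in> arc_rel G F" using F_trimmed(3)[OF a(1,2)] by (auto intro: arc_relI')
    moreover have "(x, tail G a) \<in> (arc_rel G F)\<^sup>*"
      using F_trimmed(2)[OF a(1,2)] P_reach a by auto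
    ultimately show "(x, z) \<in> (arc_rel G F)\<^sup>*" by (rule rtrancl_into_rtrancl[rotated])
  qed
  ultimately show "(w, y) \<in> (arc_rel G F)\<^sup>*"
    using rtrancl_subset_rtrancl by blast
next
  let ?F = "F - inside G X"
  let ?f = "\<lambda>x. if x \<in> P then u else x"
  have f_eq: "?f x = x" if "x \<in> verts trimmed" "colr x \<in> {Gray, Black}" for x
  proof -
    have "x \<in> X \<Longrightarrow> x = u \<or> x = \<sigma>\<^sub>V u" using that head_b by (simp add: verts_trim)
    moreover have "x \<noteq> \<sigma>\<^sub>V u" using that mate_u(3) by auto
    ultimately show ?thesis using P_iff by auto
  qed
  assume "(w, y) \<in> (arc_rel G F)\<^sup>*"
  then have "(?f w, ?f y) \<in> (arc_rel trimmed ?F)\<^sup>*"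
  proof (induction rule: rtrancl_induct)
    case (step x z)
    then obtain a where a: "a \<in> F" "tail G a = x" "head G a = z" by (auto elim: arc_relE)
    show ?case
    proof (cases "a \<in> inside G X")
      case True
      then have "x \<in> P" "z \<in> P" using a P_iff F_colr by (auto simp: inside_def)
      then show ?thesis using step.IH by simp
    next
      case False
      note Fa = F_trimmed[OF a(1) False]
      have "head trimmed a = ?f z"
      proof (cases "z \<in> P")
        case True
        then have "a = b" using Fa(5) a P_iff by blast
        then show ?thesis using True Fa(3) a head_b by simp
      qed (use Fa(3) a in simp)
      then have "(?f x, ?f z) \<in> arc_rel trimmed ?F"
        using a False Fa(2) by (intro arc_relI'[of a]) auto
      then show ?thesis using step.IH by (rule rtrancl_into_rtrancl[rotated])
    qed
  qed simp
  then show "(w, y) \<in> (arc_rel trimmed ?F)\<^sup>*"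
    using f_eq[OF w] f_eq[OF y] by simp
qed

lemma search_trimmed: "search trimmed \<sigma>\<^sub>V \<sigma>\<^sub>A (F - inside G X) colr stk r"
proof -
  interpret T: skew_symmetric_graph trimmed \<sigma>\<^sub>V \<sigma>\<^sub>A by (rule skew_symmetric_trimmed)
  have VT: "v \<in> verts trimmed \<longleftrightarrow> v \<in> verts G \<and> (v \<in> X \<longrightarrow> v = u \<or> v = \<sigma>\<^sub>V u)" for v
    using head_b by (auto simp: verts_trim)
  have gray_VT: "v \<in> verts trimmed" if "v \<in> verts G" "colr v = Gray" for v
    using that X_gray VT by blast
  let ?F = "F - inside G X"
  show ?thesis
  proof
    show "degree_property trimmed" using degree by (rule degree_property_trimmed)
    show "loop_property \<sigma>\<^sub>V trimmed" using loop by (rule loop_property_trimmed)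
    show "colr (\<sigma>\<^sub>V v) = mate_colour (colr v)" if "v \<in> verts trimmed" for v
      using that VT colr_mate by blast
    show "fst ` set stk = {v \<in> verts trimmed. colr v = Gray}"
      using gray_stack gray_VT VT by blast
    show "inj_on r {v \<in> verts trimmed. colr v \<in> {Gray, Black}}"
      by (rule inj_on_subset[OF r_inj]) (use VT in auto)
    show "?F \<subseteq> arcs trimmed" using F_trimmed(1) by blast
    show "colr (tail trimmed a) \<in> {Gray, Black} \<and> colr (head trimmed a) \<in> {Gray, Black}" if "a \<in> ?F" for a
      using F_trimmed(2,3)[of a] that F_colr[of a] u_gray by auto
    show "inj_on (head trimmed) ?F"
      using F_inj F_trimmed(3) by (auto simp: inj_on_def)
    show "\<exists>g\<in>?F. tail trimmed g = fst (stk ! Suc i) \<and> head trimmed g = fst (stk ! i)" if "Suc i < length stk" for i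
    proof (rule bexI)
      show "link (Suc i) \<in> ?F"
        using that link[of "Suc i"] link_trimmed[of "Suc i"] by (auto simp: arcs_trim inside_def)
      show "tail trimmed (link (Suc i)) = fst (stk ! Suc i) \<and> head trimmed (link (Suc i)) = fst (stk ! i)"
        using that link_trimmed[of "Suc i"] by (simp add: node_def)
    qed
    show "out_degree trimmed (fst (last stk)) \<le> 1"
    proof -
      have "last stk = stk ! (length stk - 1)" using stk_eq by (simp add: last_conv_nth)
      then have "fst (last stk) = node (length stk - 1)" by (simp add: node_def)
      moreover have "node (length stk - 1) \<notin> X"
        using node_notin_X(1)[of "length stk - 1"] tail_b_stk(2) by simp
      moreover have "stk \<noteq> []" using stk_eq by simp
      ultimately show ?thesis using root by (simp add: out_degree_def out_arcs_trimmed)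
    qed
  next
    fix w y assume "w \<in> verts trimmed" "colr w = Gray" "y \<in> verts trimmed" "colr y \<in> {Gray, Black}"
    then show "(w, y) \<in> (arc_rel trimmed ?F)\<^sup>* \<longleftrightarrow> r w \<le> r y"
      using forest_reach_trimmed[of w y] F_reach[of w y] VT by blast
  next
    fix a assume a: "a \<in> arcs trimmed" "colr (tail trimmed a) = Black"
    then have aG: "a \<in> arcs G" "\<not> (tail G a \<in> X \<and> head G a \<in> X)" by (auto simp: arcs_trim)
    have tail: "tail trimmed a = tail G a" "tail G a \<notin> X"
      using a u_gray mate_u head_b mate_b_leaving(1) by (auto simp: tail_trim split: if_splits)
    have black: "colr (tail G a) = Black" using a tail by simp
    note ba = black_arc[OF aG(1) black]
    have "a \<noteq> b" using black tail_b_stk stk_gray by auto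
    show "colr (head trimmed a) = Black \<and> r (head trimmed a) < r (tail trimmed a) \<or>
      colr (head trimmed a) = Antigray \<and> r (\<sigma>\<^sub>V (head trimmed a)) < r (tail trimmed a)"
    proof (cases "head G a \<in> X")
      case True
      then have h: "head trimmed a = \<sigma>\<^sub>V u" using a(1) \<open>a \<noteq> b\<close> head_b by (simp add: head_trim)
      \<comment> \<open>A black head in \<open>X\<close> outranks \<open>u\<close> and is outranked
        by the tail; an antigray one is the mate of \<open>u\<close> itself.\<close>
      have "r u < r (tail G a)"
      proof (cases "colr (head G a) = Black")
        case black: True
        then show ?thesis using ba X_black[OF True] by auto
      next
        case False
        then have "head G a = \<sigma>\<^sub>V u" using ba X_antigray True by blast
        then show ?thesis using ba mate_u by auto
      qed
      then show ?thesis using h tail mate_u by simp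
    next
      case False
      then show ?thesis using ba tail a by (simp add: head_trim)
    qed
  next
    fix x S' a assume x: "(x, S') \<in> set stk" "a \<in> S'" and a: "a \<in> arcs trimmed"
    then have aG: "a \<in> arcs G" "\<not> (tail G a \<in> X \<and> head G a \<in> X)" by (auto simp: arcs_trim)
    have tG: "tail G a = x" using scanned_tail x aG by blast
    have xg: "x \<in> verts G" "colr x = Gray" using x gray_stack by force+
    have "a \<noteq> \<sigma>\<^sub>A b" using mate_b_leaving(1) tG xg mate_u by auto
    then show "tail trimmed a = x"
      using a tG X_gray xg head_b by (auto simp: tail_trim)
    note sc = scanned[OF x aG(1)]
    show "colr (head trimmed a) = Black \<and>
        (\<forall>w \<in> verts trimmed. colr w = Gray \<longrightarrow> r x < r w \<longrightarrow> r (head trimmed a) < r w) \<or>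
      colr (head trimmed a) = Antigray \<and> r (\<sigma>\<^sub>V (head trimmed a)) < r x \<or>
      colr (head trimmed a) = Gray \<and> a \<in> ?F \<and> r x < r (head trimmed a)"
    proof (cases "head G a \<in> X")
      case False
      then have "head trimmed a = head G a" using a by (simp add: head_trim)
      moreover have "a \<notin> inside G X" using False by (simp add: inside_def)
      ultimately show ?thesis using sc VT by auto
    next
      case True
      then have "x \<notin> X" using aG tG by blast
      then have "x \<noteq> u" using u_in_X by blast
      then have xu: "r x < r u"
        using gray_le_top[OF xg] inj_onD[OF r_inj, of x u] xg u_gray by fastforce
      \<comment> \<open>A black head in \<open>X\<close> outranks \<open>u\<close>, contrary to the
        clause on gray nodes above \<open>x\<close>; the mate of \<open>u\<close> as head would give
        \<open>u\<close> a smaller rank than \<open>x\<close>. So an arc scanned by a call below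
        \<open>u\<close> enters \<open>X\<close> only as the forest arc \<open>b\<close>.\<close>
      from sc have "head G a = u \<and> a \<in> F"
      proof (elim disjE conjE)
        assume "colr (head G a) = Black" "\<forall>w \<in> verts G. colr w = Gray \<longrightarrow> r x < r w \<longrightarrow> r (head G a) < r w"
        then show ?thesis using X_black[OF True] u_gray xu by fastforce
      next
        assume "colr (head G a) = Antigray" "r (\<sigma>\<^sub>V (head G a)) < r x"
        then show ?thesis using X_antigray[OF True] mate_u xu by auto
      qed (use X_gray True in blast)
      then have "a = b" using entering_u aG by blast
      then have "head trimmed a = u" "a \<in> ?F" "a \<notin> inside G X"
        using b_trimmed head_b b_F tail_b_notin by (auto simp: inside_def)
      then show ?thesis using u_gray xu by simp
    qed
  qed (fact stack_sorted)
qed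

end

section \<open>Correctness of the test\<close>

context search
begin

text \<open>Black nodes only lead to black nodes of smaller rank, so no arc of a circulation starts
  at a black node. An arc with antiblack head has a mate starting at a black node, which is excluded
  in the mate circulation.\<close>

lemma weakly_acyclicI_finished:
  assumes "stk = []" and no_white: "\<And>v. v \<in> verts G \<Longrightarrow> colr v \<noteq> White"
  shows "weakly_acyclic \<sigma>\<^sub>A G"
proof (rule ccontr)
  have no_gray: "colr v \<noteq> Gray" if "v \<in> verts G" for v
    using gray_stack assms(1) that by auto
  have two: "colr v = Black \<or> colr v = Antiblack" if "v \<in> verts G" for v
    using no_gray[OF that] no_gray[OF node_mate_in[OF that]] no_white[OF that] that
    by (cases "colr v") auto
  have not_black: "colr (tail G a) \<noteq> Black" if A: "circulation \<sigma>\<^sub>A G A" and "a \<in> A" for A a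
    using that(2)
  proof (induction "r (tail G a)" arbitrary: a rule: less_induct)
    case less
    obtain c where c: "c \<in> A" "tail G c = head G a"
      using A less.prems unfolding circulation_def by blast
    have a: "a \<in> arcs G" using A less.prems by (auto simp: circulation_def)
    show ?case
    proof
      assume "colr (tail G a) = Black"
      then have "colr (head G a) = Black" "r (head G a) < r (tail G a)"
        using black_arc[OF a] two[of "head G a"] a by auto
      then show False using less.hyps[of c] c by simp
    qed
  qed
  assume "\<not> weakly_acyclic \<sigma>\<^sub>A G"
  then obtain A where A: "circulation \<sigma>\<^sub>A G A" by (rule not_weakly_acyclicE)
  then obtain a where a: "a \<in> A" "a \<in> arcs G"
    unfolding circulation_def by blast
  with A obtain c where c: "c \<in> A" "tail G c = head G a"
    unfolding circulation_def by blast
  then have "colr (head G a) = Antiblack" using two[of "head G a"] not_black[OF A c(1)] a c by auto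
  then have "colr (tail G (\<sigma>\<^sub>A a)) = Black" using a by (simp add: tail_mate)
  then show False using not_black[OF circulation_mate[OF A]] a by blast
qed

text \<open>By the ranks, the gray head reaches the top \<open>u\<close> in the forest, so
  \<open>a\<close> closes a forest path. All ends of the arcs used are gray or black, so none is the
  mate of another.\<close>

lemma not_weakly_acyclicI_gray:
  assumes stk: "stk = (u, S) # cs" and a: "a \<in> arcs G" "tail G a = u" "colr (head G a) = Gray"
  shows "\<not> weakly_acyclic \<sigma>\<^sub>A G"
proof (rule not_weakly_acyclicI)
  have u: "colr u = Gray" "u \<in> verts G" using top_gray[OF stk] by auto
  show "insert a F \<subseteq> arcs G" using a F_sub by blast
  show "mate_free \<sigma>\<^sub>A (insert a F)"
  proof -
    have "\<sigma>\<^sub>A a \<notin> F" using F_colr[of "\<sigma>\<^sub>A a"] a by (auto simp: tail_mate)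
    moreover have "\<sigma>\<^sub>A f \<noteq> a" if "f \<in> F" for f
      using F_colr[OF that] F_arcs[OF that] tail_mate[of f] a u by auto
    ultimately show ?thesis
      using arc_mate_neq[OF a(1)] mate_not_F by (auto simp: mate_free_def)
  qed
  have "(head G a, u) \<in> (arc_rel G F)\<^sup>*"
    using F_reach[of "head G a" u] gray_le_top[OF stk, of "head G a"] a u by simp
  then have "(head G a, u) \<in> (arc_rel G (insert a F))\<^sup>*"
    by (rule arc_rel_rtrancl_mono) blast
  moreover have "(u, head G a) \<in> arc_rel G (insert a F)" using a by (auto intro: arc_relI')
  ultimately show "(u, u) \<in> (arc_rel G (insert a F))\<^sup>+" by (rule rtrancl_into_trancl2[rotated])
qed

lemma rank_bound: "\<exists>t. \<forall>w \<in> verts G. r w < t"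
proof -
  have "\<forall>w \<in> verts G. r w < Suc (Max (r ` verts G))"
    by (simp add: le_imp_less_Suc)
  then show ?thesis by blast
qed

lemma search_skip:
  assumes stk: "stk = (u, S) # cs" and a: "a \<in> arcs G" "tail G a = u" "colr (head G a) \<in> {Black, Antigray}"
  shows "search G \<sigma>\<^sub>V \<sigma>\<^sub>A F colr ((u, insert a S) # cs) r"
proof -
  have u: "colr u = Gray" "u \<in> verts G" using top_gray[OF stk] by auto
  have black: "\<forall>w \<in> verts G. colr w = Gray \<longrightarrow> r u < r w \<longrightarrow> r (head G a) < r w"
    using gray_le_top[OF stk] by fastforce
  \<comment> \<open>The loop property excludes \<open>u\<close> itself as the mate of the head,
    which makes the inequality strict.\<close>
  have anti: "r (\<sigma>\<^sub>V (head G a)) < r u" if h: "colr (head G a) = Antigray"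
  proof -
    have m: "\<sigma>\<^sub>V (head G a) \<in> verts G" "colr (\<sigma>\<^sub>V (head G a)) = Gray"
      using h a node_mate_in by auto
    have "\<sigma>\<^sub>V (head G a) \<noteq> u"
      using no_arc_to_mate[OF a(1)] a node_mate_mate by (metis head_in_verts)
    then show ?thesis
      using gray_le_top[OF stk m] inj_onD[OF r_inj, of "\<sigma>\<^sub>V (head G a)" u] m u by fastforce
  qed
  show ?thesis
    using search_insert_scanned[of "[]" u S cs a] stk a black anti by auto
qed

text \<open>The mate of \<open>a\<close> leads from the black mate of the head to the antigray mate
  of \<open>u\<close>. So \<open>black_arc\<close> places that black node above \<open>u\<close> in
  rank, and by \<open>F_reach\<close> it is a descendant of \<open>u\<close>. The root is no
  candidate for \<open>u\<close>, since \<open>a\<close> and a forest arc would both leave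
  it.\<close>

lemma blossom_exists:
  assumes stk: "stk = (u, S) # cs" and a: "a \<in> arcs G" "tail G a = u" "colr (head G a) = Antiblack"
  obtains b p where "scan_blossom G \<sigma>\<^sub>V \<sigma>\<^sub>A F colr stk r u S cs a b p
      (set (awalk_verts u p) \<union> \<sigma>\<^sub>V ` set (awalk_verts u p))" "in_arcs forest u = {b}"
proof -
  interpret Fo: wf_digraph forest by (rule wf_forest)
  let ?v = "\<sigma>\<^sub>V (head G a)"
  have u: "colr u = Gray" "u \<in> verts G" using top_gray[OF stk] by auto
  have v: "colr ?v = Black" "?v \<in> verts G" using a by (simp_all add: node_mate_in)
  have ma: "colr (head G (\<sigma>\<^sub>A a)) = Antigray" "\<sigma>\<^sub>V (head G (\<sigma>\<^sub>A a)) = u"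
    "tail G (\<sigma>\<^sub>A a) = ?v" "\<sigma>\<^sub>A a \<in> arcs G"
    using a u by (simp_all add: head_mate tail_mate node_mate_mate arc_mate_in)
  then have "r u < r ?v" using black_arc[of "\<sigma>\<^sub>A a"] v by auto
  then have "(u, ?v) \<in> (arc_rel G F)\<^sup>*" using F_reach[of u ?v] u v by simp
  then have "u \<rightarrow>\<^sup>*\<^bsub>forest\<^esub> ?v" using Fo.reachable_conv'[of u ?v] u by (simp add: arcs_ends_forest)
  then obtain p where p: "Fo.apath u p ?v" using Fo.reachable_apath by blast
  have "cs \<noteq> []"
  proof
    assume "cs = []"
    then have out: "card (out_arcs G u) \<le> Suc 0" using root stk by (simp add: out_degree_def)
    have pF: "set p \<subseteq> F" "cas u p ?v"
      using p by (simp_all add: Fo.apath_def Fo.awalk_def forest_cas)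
    have "p \<noteq> []" using pF u v by auto
    then obtain g where "g \<in> F" "tail G g = u" using pF by (cases p) auto
    then have "g \<in> out_arcs G u" "a \<in> out_arcs G u" using a F_arcs by auto
    then have "g = a" using out by (metis card_le_Suc0_iff_eq finite_out_arcs)
    then show False using F_colr[OF \<open>g \<in> F\<close>] a by auto
  qed
  then obtain b where b: "b \<in> F" "head G b = u"
    using F_stack[of 0] stk by (cases cs) auto
  have "in_arcs forest u = {b}"
    using b F_inj by (auto dest: inj_onD)
  moreover have "scan_blossom G \<sigma>\<^sub>V \<sigma>\<^sub>A F colr stk r u S cs a b p
      (set (awalk_verts u p) \<union> \<sigma>\<^sub>V ` set (awalk_verts u p))"
    by unfold_locales (use stk a b p in auto)
  ultimately show thesis using that by blast
qed

end

text \<open>The ranks are quantified existentially, as the state does not carry them. The last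
  clause transfers a verdict on the current graph to \<open>G\<close>.\<close>

definition search_invariant ::
  "('a \<Rightarrow> 'a) \<Rightarrow> ('b \<Rightarrow> 'b) \<Rightarrow> ('a, 'b) pre_digraph \<Rightarrow> ('a, 'b) state \<Rightarrow> bool" where
  "search_invariant \<sigma>\<^sub>V \<sigma>\<^sub>A G s \<longleftrightarrow>
     (\<exists>r. search (cur_graph s) \<sigma>\<^sub>V \<sigma>\<^sub>A (forest_arcs s) (col s) (stack s) r) \<and>
     forest_nodes s = {v \<in> verts (cur_graph s). col s v \<in> {Gray, Black}} \<and>
     verts (cur_graph s) \<subseteq> verts G \<and>
     (weakly_acyclic \<sigma>\<^sub>A (cur_graph s) \<longleftrightarrow> weakly_acyclic \<sigma>\<^sub>A G)"

text \<open>Entering a call uses up a white node, returning shortens the stack, trimming removes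
  arcs, and skipping consumes an unscanned arc; each leaves the earlier components unchanged. White
  nodes are counted in the initial graph, so that trimming does not alter their number.\<close>

definition search_measure ::
  "('a, 'b) pre_digraph \<Rightarrow> ('a, 'b) state \<Rightarrow> nat \<times> nat \<times> nat \<times> nat" where
  "search_measure G s =
     (card {v \<in> verts G. col s v = White}, length (stack s), card (arcs (cur_graph s)),
      case stack s of [] \<Rightarrow> 0 | (u, S) # _ \<Rightarrow> card (out_arcs (cur_graph s) u - S))"

definition search_order :: "('a, 'b) pre_digraph \<Rightarrow> ('a, 'b) state rel" where
  "search_order G = inv_image (less_than <*lex*> less_than <*lex*> less_than <*lex*> less_than) (search_measure G)"

lemma wf_search_order: "wf (search_order G)"
  unfolding search_order_def by (intro wf_inv_image wf_lex_prod wf_less_than)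

lemma enter_call_white:
  assumes "finite (verts G)" "v \<in> verts G" "col s v = White"
  shows "card {w \<in> verts G. col (enter_call \<sigma>\<^sub>V v q s) w = White} < card {w \<in> verts G. col s w = White}"
  using assms by (intro psubset_card_mono) (auto simp: enter_call_def)

lemma search_forest_graph:
  assumes "search (cur_graph s) \<sigma>\<^sub>V \<sigma>\<^sub>A (forest_arcs s) (col s) (stack s) r"
    and "forest_nodes s = {v \<in> verts (cur_graph s). col s v \<in> {Gray, Black}}"
  shows "forest_graph s = search.forest (cur_graph s) (forest_arcs s) (col s)"
  using assms by (simp add: search.forest_def forest_graph_def)

lemma search_invariant_step:
  assumes fin: "finite (verts G)" and inv: "search_invariant \<sigma>\<^sub>V \<sigma>\<^sub>A G s" and step: "step \<sigma>\<^sub>V \<sigma>\<^sub>A (Running s) c"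
  shows "case c of Running s' \<Rightarrow> search_invariant \<sigma>\<^sub>V \<sigma>\<^sub>A G s' \<and> (s', s) \<in> search_order G
    | Halted rep \<Rightarrow> rep = (if weakly_acyclic \<sigma>\<^sub>A G then No_Regular_Cycle else Regular_Cycle)"
proof -
  let ?H = "cur_graph s"
  from inv obtain r where S: "search ?H \<sigma>\<^sub>V \<sigma>\<^sub>A (forest_arcs s) (col s) (stack s) r"
    and nodes: "forest_nodes s = {v \<in> verts ?H. col s v \<in> {Gray, Black}}"
    and sub: "verts ?H \<subseteq> verts G"
    and wa: "weakly_acyclic \<sigma>\<^sub>A ?H \<longleftrightarrow> weakly_acyclic \<sigma>\<^sub>A G"
    by (auto simp: search_invariant_def)
  interpret search ?H \<sigma>\<^sub>V \<sigma>\<^sub>A "forest_arcs s" "col s" "stack s" r by (fact S)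
  obtain t where t: "\<And>w. w \<in> verts ?H \<Longrightarrow> r w < t" using rank_bound by blast
  have nodes_enter: "insert v (forest_nodes s) =
      {w \<in> verts ?H. ((col s)(v := Gray, \<sigma>\<^sub>V v := Antigray)) w \<in> {Gray, Black}}"
    if "v \<in> verts ?H" "col s v = White" for v
    using that node_mate_neq[of v] colr_mate_iff(1)[of v] by (auto simp: nodes)
  from step show ?thesis
  proof (cases rule: step.cases)
    case (start v)
    let ?s = "enter_call \<sigma>\<^sub>V v None s"
    have "search ?H \<sigma>\<^sub>V \<sigma>\<^sub>A (forest_arcs ?s) (col ?s) (stack ?s) (r(v := t))"
      using search_enter[OF start(3,4) t, of None] start by (simp add: enter_call_def)
    then have "search_invariant \<sigma>\<^sub>V \<sigma>\<^sub>A G ?s"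
      using nodes_enter[OF start(3,4)] sub wa unfolding search_invariant_def
      by (auto simp: enter_call_def)
    moreover have "(?s, s) \<in> search_order G"
      using enter_call_white[OF fin, of v s \<sigma>\<^sub>V None] start sub
      by (auto simp: search_order_def search_measure_def)
    ultimately show ?thesis using start by simp
  next
    case finish
    then have "weakly_acyclic \<sigma>\<^sub>A ?H" by (intro weakly_acyclicI_finished) auto
    then show ?thesis using finish wa by simp
  next
    case (scan_gray u S cs a)
    then have "\<not> weakly_acyclic \<sigma>\<^sub>A ?H" by (intro not_weakly_acyclicI_gray[of u S cs a]) auto
    then show ?thesis using scan_gray wa by simp
  next
    case (scan_white u S cs a v)
    let ?old = "s\<lparr>stack := (u, insert a S) # cs\<rparr>"
    let ?s = "enter_call \<sigma>\<^sub>V v (Some a) ?old"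
    have a: "a \<in> arcs ?H" "tail ?H a = u" "head ?H a = v" using scan_white by auto
    have v: "v \<in> verts ?H" using a by auto
    have uv: "u \<noteq> v" "u \<in> verts ?H" using top_gray[OF scan_white(2)] scan_white by auto
    have q: "case Some a of None \<Rightarrow> stack s = [] \<and> out_degree ?H v \<le> 1
        | Some a \<Rightarrow> stack s \<noteq> [] \<and> a \<in> arcs ?H \<and> tail ?H a = fst (hd (stack s)) \<and> head ?H a = v"
      using scan_white(2) a by simp
    interpret E: search ?H \<sigma>\<^sub>V \<sigma>\<^sub>A "forest_arcs s \<union> set_option (Some a)"
      "(col s)(v := Gray, \<sigma>\<^sub>V v := Antigray)" "(v, {}) # stack s" "r(v := t)"
      by (rule search_enter[OF v scan_white(5) _ q]) (rule t)
    have "search ?H \<sigma>\<^sub>V \<sigma>\<^sub>A (forest_arcs ?s) (col ?s) (stack ?s) (r(v := t))"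
      using E.search_insert_scanned[of "[(v, {})]" u S cs a] scan_white(2) a uv t[of u] node_mate_neq[OF v]
      by (simp add: enter_call_def)
    then have "search_invariant \<sigma>\<^sub>V \<sigma>\<^sub>A G ?s"
      using nodes_enter[OF v scan_white(5)] sub wa unfolding search_invariant_def
      by (auto simp: enter_call_def)
    moreover have "(?s, s) \<in> search_order G"
      using enter_call_white[OF fin, of v ?old \<sigma>\<^sub>V "Some a"] scan_white(5) sub v
      by (auto simp: search_order_def search_measure_def)
    ultimately show ?thesis using scan_white by simp
  next
    case (scan_antiblack u S cs a v p P X b)
    let ?old = "s\<lparr>stack := (u, insert a S) # cs\<rparr>"
    let ?s = "trim_state \<sigma>\<^sub>V \<sigma>\<^sub>A u X b ?old"
    have a: "a \<in> arcs ?H" "tail ?H a = u" "head ?H a = v" using scan_antiblack by auto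
    note forest = search_forest_graph[OF S nodes]
    have b: "b \<in> forest_arcs s" "head ?H b = u"
      using scan_antiblack(9) by (auto simp: forest)
    interpret B: scan_blossom ?H \<sigma>\<^sub>V \<sigma>\<^sub>A "forest_arcs s" "col s" "stack s" r u S cs a b p X
      by unfold_locales
        (use scan_antiblack(2,5,6,7,8) a b in \<open>auto simp: forest forest_awalk_verts\<close>)
    let ?T = "B.trimmed"
    interpret T: search ?T \<sigma>\<^sub>V \<sigma>\<^sub>A "forest_arcs s - inside ?H X" "col s" "stack s" r
      by (rule B.search_trimmed)
    \<comment> \<open>The mate of the head of \<open>a\<close> is the end of \<open>p\<close>, so
      both ends of \<open>a\<close> lie in \<open>X\<close> and the trimming deletes it. This
      decreases the measure and makes recording \<open>a\<close> as scanned harmless.\<close>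
    have "head ?H a \<in> X"
      using B.end_in_P B.X_eq B.X_mate_iff a by (metis UnI1 head_in_verts)
    then have a_notin: "a \<notin> arcs ?T"
      using a B.u_in_X by (simp add: B.arcs_trim)
    then have "search ?T \<sigma>\<^sub>V \<sigma>\<^sub>A (forest_arcs ?s) (col ?s) (stack ?s) r"
      using T.search_insert_scanned[of "[]" u S cs a] scan_antiblack(2) by (simp add: trim_state_def)
    moreover have "forest_nodes ?s = {v \<in> verts ?T. col ?s v \<in> {Gray, Black}}"
      using nodes B.verts_trim b by (auto simp: trim_state_def)
    moreover have "verts ?T \<subseteq> verts G" using sub B.verts_trim by blast
    ultimately have "search_invariant \<sigma>\<^sub>V \<sigma>\<^sub>A G ?s"
      using wa B.weakly_acyclic_trimmed_iff unfolding search_invariant_def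
      by (auto simp: trim_state_def)
    moreover have "(?s, s) \<in> search_order G"
    proof -
      have "card (arcs ?T) < card (arcs ?H)"
        using a_notin a B.arcs_trim by (intro psubset_card_mono) auto
      then show ?thesis
        using scan_antiblack(2) by (simp add: search_order_def search_measure_def trim_state_def)
    qed
    ultimately show ?thesis using scan_antiblack by simp
  next
    case (scan_skip u S cs a)
    let ?s = "s\<lparr>stack := (u, insert a S) # cs\<rparr>"
    have a: "a \<in> arcs ?H" "tail ?H a = u" using scan_skip by auto
    have "search_invariant \<sigma>\<^sub>V \<sigma>\<^sub>A G ?s"
      using search_skip[OF scan_skip(2) a scan_skip(4)] nodes sub wa
      by (auto simp: search_invariant_def)
    moreover have "(?s, s) \<in> search_order G"
    proof -
      have "out_arcs ?H u - insert a S \<subset> out_arcs ?H u - S"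
        using scan_skip(3) by blast
      then have "card (out_arcs ?H u - insert a S) < card (out_arcs ?H u - S)"
        by (rule psubset_card_mono[rotated]) (intro finite_Diff finite_out_arcs)
      then show ?thesis
        using scan_skip(2) by (simp add: search_order_def search_measure_def)
    qed
    ultimately show ?thesis using scan_skip by simp
  next
    case (return u S cs)
    let ?s = "s\<lparr>col := (col s)(u := Black, \<sigma>\<^sub>V u := Antiblack), stack := cs\<rparr>"
    have u: "col s u = Gray" "u \<in> verts ?H" using top_gray[OF return(2)] by auto
    then have mu: "col s (\<sigma>\<^sub>V u) = Antigray" "\<sigma>\<^sub>V u \<noteq> u" using node_mate_neq by auto
    have "search ?H \<sigma>\<^sub>V \<sigma>\<^sub>A (forest_arcs s) (col ?s) (stack ?s) (r(u := t))"
      using search_return[OF return(2,3) t] by simp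
    moreover have "forest_nodes s = {v \<in> verts ?H. col ?s v \<in> {Gray, Black}}"
      using u mu by (auto simp: nodes)
    ultimately have "search_invariant \<sigma>\<^sub>V \<sigma>\<^sub>A G ?s"
      using sub wa unfolding search_invariant_def by auto
    moreover have "{v \<in> verts G. col ?s v = White} = {v \<in> verts G. col s v = White}"
      using u mu by auto
    then have "(?s, s) \<in> search_order G"
      using return(2) by (simp add: search_order_def search_measure_def)
    ultimately show ?thesis using return by simp
  qed
qed

text \<open>The assertions built into the rules follow from the invariant: one of two white mates
  has out-degree at most one, as the in-degree of a node is the out-degree of its mate, and
  \<open>blossom_exists\<close> with \<open>bud_X\<close> supplies the premises of
  \<open>scan_antiblack\<close>.\<close>

lemma search_invariant_progress:
  assumes inv: "search_invariant \<sigma>\<^sub>V \<sigma>\<^sub>A G s"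
  shows "\<exists>c. step \<sigma>\<^sub>V \<sigma>\<^sub>A (Running s) c"
proof -
  let ?H = "cur_graph s"
  from inv obtain r where S: "search ?H \<sigma>\<^sub>V \<sigma>\<^sub>A (forest_arcs s) (col s) (stack s) r"
    and nodes: "forest_nodes s = {v \<in> verts ?H. col s v \<in> {Gray, Black}}"
    by (auto simp: search_invariant_def)
  interpret search ?H \<sigma>\<^sub>V \<sigma>\<^sub>A "forest_arcs s" "col s" "stack s" r by (fact S)
  note forest = search_forest_graph[OF S nodes]
  show ?thesis
  proof (cases "stack s")
    case Nil
    show ?thesis
    proof (cases "\<exists>v \<in> verts ?H. col s v = White \<and> col s (\<sigma>\<^sub>V v) = White")
      case True
      then obtain v where v: "v \<in> verts ?H" "col s v = White" "col s (\<sigma>\<^sub>V v) = White" by blast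
      then have mv: "\<sigma>\<^sub>V v \<in> verts ?H" "\<sigma>\<^sub>V (\<sigma>\<^sub>V v) = v" by (simp_all add: node_mate_in node_mate_mate)
      consider "out_degree ?H v \<le> 1" | "out_degree ?H (\<sigma>\<^sub>V v) \<le> 1"
        using degree v(1) out_degree_mate by (auto simp: degree_property_def)
      then show ?thesis
        using step.start[of s v \<sigma>\<^sub>V \<sigma>\<^sub>A] step.start[of s "\<sigma>\<^sub>V v" \<sigma>\<^sub>V \<sigma>\<^sub>A] Nil v mv by cases auto
    qed (use step.finish[OF Nil] in blast)
  next
    case (Cons us cs)
    obtain u S' where us: "us = (u, S')" by (cases us)
    note stk = Cons[unfolded us]
    show ?thesis
    proof (cases "out_arcs ?H u \<subseteq> S'")
      case False
      then obtain a where a: "a \<in> out_arcs ?H u - S'" by blast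
      show ?thesis
      proof (cases "col s (head ?H a)")
        case Antiblack
        obtain b p where bp: "scan_blossom ?H \<sigma>\<^sub>V \<sigma>\<^sub>A (forest_arcs s) (col s) (stack s) r u S' cs a b p
            (set (awalk_verts u p) \<union> \<sigma>\<^sub>V ` set (awalk_verts u p))" "in_arcs forest u = {b}"
          using blossom_exists[OF stk, of a] a Antiblack by auto
        then interpret B: scan_blossom ?H \<sigma>\<^sub>V \<sigma>\<^sub>A "forest_arcs s" "col s" "stack s" r u S' cs a b p
          "set (awalk_verts u p) \<union> \<sigma>\<^sub>V ` set (awalk_verts u p)" by blast
        have "step \<sigma>\<^sub>V \<sigma>\<^sub>A (Running s) (Running (trim_state \<sigma>\<^sub>V \<sigma>\<^sub>A u
            (set (awalk_verts u p) \<union> \<sigma>\<^sub>V ` set (awalk_verts u p)) b (s\<lparr>stack := (u, insert a S') # cs\<rparr>)))"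
          using B.p_forest bp(2) B.bud_X
          by (intro step.scan_antiblack[OF stk a refl Antiblack]) (simp_all add: forest forest_awalk_verts)
        then show ?thesis by blast
      qed (use step.scan_white[OF stk a refl] step.scan_gray[OF stk a] step.scan_skip[OF stk a] in blast)+
    qed (use step.return[OF stk] in blast)
  qed
qed

lemma no_step_Halted: "\<not> step \<sigma>\<^sub>V \<sigma>\<^sub>A (Halted rep) c"
  by (auto elim: step.cases)

theorem theorem6p2:
  fixes G :: "('a, 'b) pre_digraph" and \<sigma>\<^sub>V :: "'a \<Rightarrow> 'a" and \<sigma>\<^sub>A :: "'b \<Rightarrow> 'b"
  assumes "skew_symmetric_graph G \<sigma>\<^sub>V \<sigma>\<^sub>A"
    and "degree_property G"
    and "loop_property \<sigma>\<^sub>V G"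
  shows "(weakly_acyclic \<sigma>\<^sub>A G \<longleftrightarrow> acyclicity_test_reports \<sigma>\<^sub>V \<sigma>\<^sub>A G No_Regular_Cycle) \<and>
         (\<not> weakly_acyclic \<sigma>\<^sub>A G \<longleftrightarrow> acyclicity_test_reports \<sigma>\<^sub>V \<sigma>\<^sub>A G Regular_Cycle)"
proof -
  interpret skew_symmetric_graph G \<sigma>\<^sub>V \<sigma>\<^sub>A by fact
  let ?step = "step \<sigma>\<^sub>V \<sigma>\<^sub>A"
  define answer where "answer = (if weakly_acyclic \<sigma>\<^sub>A G then No_Regular_Cycle else Regular_Cycle)"
  define ok where "ok c = (case c of Running s \<Rightarrow> search_invariant \<sigma>\<^sub>V \<sigma>\<^sub>A G s | Halted rep \<Rightarrow> rep = answer)" for c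
  obtain s0 where s0: "init_config G = Running s0" and "ok (init_config G)"
    using search_initial[OF assms, of "\<lambda>_. 0"]
    by (simp add: init_config_def ok_def search_invariant_def) blast
  have step_ok: "ok d \<and> (\<forall>s s'. c = Running s \<longrightarrow> d = Running s' \<longrightarrow> (s', s) \<in> search_order G)"
    if "ok c" "?step c d" for c d
  proof (cases c)
    case (Running s)
    then show ?thesis
      using search_invariant_step[OF finite_verts, of \<sigma>\<^sub>V \<sigma>\<^sub>A s d] that
      by (cases d) (auto simp: ok_def answer_def)
  qed (use that no_step_Halted in blast)
  have reach_ok: "ok c" if "?step\<^sup>*\<^sup>* (init_config G) c" for c
    using that by (induction rule: rtranclp_induct) (use \<open>ok (init_config G)\<close> step_ok in blast)+
  have final: "c = Halted answer" if "?step\<^sup>*\<^sup>* (init_config G) c" "\<not> (\<exists>d. ?step c d)" for c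
    using reach_ok[OF that(1)] that(2) search_invariant_progress[of \<sigma>\<^sub>V \<sigma>\<^sub>A G]
    by (cases c) (auto simp: ok_def)
  have terminates: "\<not> (\<exists>f. f 0 = init_config G \<and> (\<forall>i::nat. ?step (f i) (f (Suc i))))"
  proof
    assume "\<exists>f. f 0 = init_config G \<and> (\<forall>i::nat. ?step (f i) (f (Suc i)))"
    then obtain f where f: "f 0 = init_config G" "\<And>i::nat. ?step (f i) (f (Suc i))" by blast
    have ok: "ok (f i)" for i
      by (induction i) (use f \<open>ok (init_config G)\<close> step_ok in auto)
    have "\<exists>s. f i = Running s" for i
      using f(2)[of i] no_step_Halted by (cases "f i") auto
    then obtain s where s: "\<And>i. f i = Running (s i)" by metis
    have "(s (Suc i), s i) \<in> search_order G" for i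
      using step_ok[OF ok f(2)] s by blast
    then show False
      using wf_search_order[of G] by (meson wf_iff_no_infinite_down_chain)
  qed
  \<comment> \<open>\<open>acyclicity_test_reports\<close> speaks about all reachable final
    configurations and, given termination, would hold for both reports if there were none. A halting
    run is therefore produced, which refutes the wrong report.\<close>
  have "\<exists>c. ?step\<^sup>*\<^sup>* (Running s) c \<and> \<not> (\<exists>d. ?step c d)" if "ok (Running s)" for s
    using wf_search_order[of G] that
  proof (induction s rule: wf_induct_rule)
    case (less s)
    then obtain d where d: "?step (Running s) d"
      using search_invariant_progress[of \<sigma>\<^sub>V \<sigma>\<^sub>A G s] by (auto simp: ok_def)
    show ?case
    proof (cases d)
      case (Running s')
      then obtain c where "?step\<^sup>*\<^sup>* (Running s') c" "\<not> (\<exists>e. ?step c e)"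
        using less.IH[of s'] step_ok[OF less.prems d] by blast
      then show ?thesis using d Running by (meson converse_rtranclp_into_rtranclp)
    qed (use d no_step_Halted in blast)
  qed
  then obtain c where c: "?step\<^sup>*\<^sup>* (init_config G) c" "\<not> (\<exists>d. ?step c d)"
    using s0 \<open>ok (init_config G)\<close> by metis
  have "acyclicity_test_reports \<sigma>\<^sub>V \<sigma>\<^sub>A G rep \<longleftrightarrow> rep = answer" for rep
    using terminates final c unfolding acyclicity_test_reports_def by blast
  then show ?thesis by (simp add: answer_def)
qed

end
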